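(* Let $\lambda$ be a Dyck path of length $2n$ with corresponding plane forest $F$. Let $L_0$ be the increasing labeling of $F$ such that $\mathrm{pre}(L_0)$ is the identity permutation of $[n]$, and let $\pi_0=\mathrm{post}(L_0)$. Then $$\sum_{D\in \mathcal{D}(\lambda/* )} q^{\mathrm{art}(D)} = \sum_{\pi\ge_L\pi_0} q^{\mathrm{inv}(\pi)-\mathrm{inv}(\pi_0)},$$ where the sum on the right is over all $\pi\in\mathfrak{S}_n$ with $\pi\ge_L\pi_0$, and $\ge_L$ is the left weak order on $\mathfrak{S}_n$.
   Context: Dyck tilings. A Dyck path of length $2n$ is a lattice path of up steps $(0,1)$ and down steps $(1,0)$ from $(0,0)$ to $(n,n)$ never going strictly below the line $y=x$. Cells are unit squares with integer corners. A Dyck tile is a ribbon (finite set of cells) such that the centers of its cells are the lattice points of a translate of a Dyck path (a Dyck path of length $0$ is allowed, giving a single cell). For Dyck paths $\lambda,\mu$ of length $2n$ with $\mu$ weakly above $\lambda$, a Dyck tiling of $\lambda/\mu$ is a tiling $D$ by Dyck tiles of the region between $\lambda$ and $\mu$ that is cover-inclusive: if $\eta$ is a tile of $D$, then the translate of $\eta$ by $(1,-1)$ is either completely below $\lambda$ or contained in another tile of $D$. $\lambda$ is the lower path and $\mu$ the upper path. $\mathcal{D}(\lambda/* )$ is the set of Dyck tilings with fixed lower path $\lambda$ (and arbitrary upper path). For such $D$, $\mathrm{tiles}(D)$ is the number of tiles, $\mathrm{area}(D)$ is the area (number of cells) of the region $\lambda/\mu$, and $\mathrm{art}(D)=(\mathrm{area}(D)+\mathrm{tiles}(D))/2$.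 Forests. The plane forest $F$ of $\lambda$ has one vertex for each pair consisting of an up step and its matching (facing) down step; a vertex is a descendant of another if its pair is nested inside the other pair, and the left-to-right order of the forest is the order along the path. An increasing labeling of $F$ (with $n$ vertices) is a bijective labeling of the vertices by $1,\dots,n$ such that each label is greater than the label of the parent. $\mathrm{pre}(L)$ (resp. $\mathrm{post}(L)$) is the permutation, in one-line notation, obtained by reading the labels of $L$ from left to right in pre-order (parent before its subtrees) (resp. post-order (parent after its subtrees)). Permutations. $\mathrm{inv}(\pi)$ is the number of pairs $i<j$ with $\pi(i)>\pi(j)$. The left weak order on $\mathfrak{S}_n$ is the partial order whose covers are $\pi<_L s_i\pi$ with $\mathrm{inv}(s_i\pi)=\mathrm{inv}(\pi)+1$, where $s_i\pi$ is obtained from the one-line notation of $\pi$ by exchanging the values $i$ and $i+1$. *)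

theory Defs
  imports
    "HOL-Combinatorics.Multiset_Permutations"
    "HOL-Computational_Algebra.Polynomial"
begin

section \<open>Dyck paths\<close>

datatype step = Up | Down

text \<open>The lattice point reached after the first \<open>k\<close> steps, where \<open>Up\<close> is \<open>(0,1)\<close> and
  \<open>Down\<close> is \<open>(1,0)\<close>.\<close>

definition point :: "step list \<Rightarrow> nat \<Rightarrow> int \<times> int" where
  "point p k = (int (count_list (take k p) Down), int (count_list (take k p) Up))"

definition points :: "step list \<Rightarrow> (int \<times> int) set" where
  "points p = point p ` {..length p}"

definition dyck_path :: "nat \<Rightarrow> step list \<Rightarrow> bool" where
  "dyck_path n p \<longleftrightarrow> length p = 2 * n \<and> point p (2 * n) = (int n, int n) \<and>
     (\<forall>(x, y) \<in> points p. x \<le> y)"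

text \<open>For lattice paths of the same length with the same start, \<open>q\<close> is weakly above \<open>p\<close> iff on each
  antidiagonal \<open>x + y = k\<close> the point of \<open>q\<close> is at least as high as that of \<open>p\<close>.\<close>

definition weakly_above :: "step list \<Rightarrow> step list \<Rightarrow> bool" where
  "weakly_above q p \<longleftrightarrow> length q = length p \<and> (\<forall>k \<le> length p. snd (point p k) \<le> snd (point q k))"

section \<open>Dyck tilings\<close>

text \<open>A cell is represented by its lower left corner: \<open>(a, b)\<close> is the unit square
  \<open>[a, a+1] \<times> [b, b+1]\<close>.  It lies below a path iff its upper left corner \<open>(a, b+1)\<close> is weakly to
  the lower right of some point of the path, and above the path iff its lower right corner
  \<open>(a+1, b)\<close> is weakly to the upper left of some point of the path.\<close>

type_synonym cell = "int \<times> int"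

definition cell_below :: "step list \<Rightarrow> cell \<Rightarrow> bool" where
  "cell_below p c \<longleftrightarrow> (\<exists>(x, y) \<in> points p. x \<le> fst c \<and> snd c + 1 \<le> y)"

definition cell_above :: "step list \<Rightarrow> cell \<Rightarrow> bool" where
  "cell_above p c \<longleftrightarrow> (\<exists>(x, y) \<in> points p. fst c + 1 \<le> x \<and> y \<le> snd c)"

definition region :: "step list \<Rightarrow> step list \<Rightarrow> cell set" where
  "region lam mu = {c. cell_above lam c \<and> cell_below mu c}"

text \<open>The centers of the cells of a tile are the points of a translate of a Dyck path; shifting by
  \<open>(1/2, 1/2)\<close>, so are their lower left corners.\<close>

definition dyck_tile :: "cell set \<Rightarrow> bool" where
  "dyck_tile t \<longleftrightarrow> (\<exists>m p a b. dyck_path m p \<and> t = (\<lambda>(x, y). (a + x, b + y)) ` points p)"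

definition shift_tile :: "cell set \<Rightarrow> cell set" where
  "shift_tile t = (\<lambda>(a, b). (a + 1, b - 1)) ` t"

definition cover_inclusive :: "step list \<Rightarrow> cell set set \<Rightarrow> bool" where
  "cover_inclusive lam D \<longleftrightarrow>
     (\<forall>t \<in> D. (\<forall>c \<in> shift_tile t. cell_below lam c) \<or> (\<exists>t' \<in> D. t' \<noteq> t \<and> shift_tile t \<subseteq> t'))"

definition dyck_tiling :: "step list \<Rightarrow> step list \<Rightarrow> cell set set \<Rightarrow> bool" where
  "dyck_tiling lam mu D \<longleftrightarrow>
     (\<forall>t \<in> D. dyck_tile t) \<and> disjoint D \<and> \<Union>D = region lam mu \<and> cover_inclusive lam D"

text \<open>The set \<open>\<D>(\<lambda>/*)\<close>; a tiling is recorded together with its upper path.\<close>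

definition dyck_tilings :: "nat \<Rightarrow> step list \<Rightarrow> (step list \<times> cell set set) set" where
  "dyck_tilings n lam = {(mu, D). dyck_path n mu \<and> weakly_above mu lam \<and> dyck_tiling lam mu D}"

definition tiles :: "step list \<times> cell set set \<Rightarrow> nat" where
  "tiles T = card (snd T)"

definition area :: "step list \<Rightarrow> step list \<times> cell set set \<Rightarrow> nat" where
  "area lam T = card (region lam (fst T))"

text \<open>The division is exact, see \<open>even_area_plus_tiles\<close> below.\<close>

definition art :: "step list \<Rightarrow> step list \<times> cell set set \<Rightarrow> nat" where
  "art lam T = (area lam T + tiles T) div 2"

section \<open>Plane forests and increasing labelings\<close>

datatype 'a tree = Node (vertex: 'a) (subtrees: "'a tree list")

fun preorder :: "'a tree \<Rightarrow> 'a list" where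
  "preorder (Node v ts) = v # concat (map preorder ts)"

fun postorder :: "'a tree \<Rightarrow> 'a list" where
  "postorder (Node v ts) = concat (map postorder ts) @ [v]"

definition forest_preorder :: "'a tree list \<Rightarrow> 'a list" where
  "forest_preorder F = concat (map preorder F)"

definition forest_postorder :: "'a tree list \<Rightarrow> 'a list" where
  "forest_postorder F = concat (map postorder F)"

definition forest_vertices :: "'a tree list \<Rightarrow> 'a set" where
  "forest_vertices F = set (forest_preorder F)"

text \<open>The up step at position \<open>i\<close> and the down step at position \<open>j\<close> (counted from 0) face each other
  iff the part of the path strictly between them is a Dyck path.\<close>

definition matched :: "step list \<Rightarrow> nat \<Rightarrow> nat \<Rightarrow> bool" where
  "matched p i j \<longleftrightarrow> i < j \<and> j < length p \<and> p ! i = Up \<and> p ! j = Down \<and>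
     (\<exists>m. dyck_path m (take (j - Suc i) (drop (Suc i) p)))"

definition partner :: "step list \<Rightarrow> nat \<Rightarrow> nat" where
  "partner p i = (THE j. matched p i j)"

text \<open>The plane forest of the part of \<open>p\<close> at positions \<open>i, \<dots>, k - 1\<close>; a vertex is the pair of
  positions of an up step and its matching down step.  The two bounds on \<open>partner p i\<close> hold
  automatically when that part is a Dyck path; they only ensure termination.\<close>

function forest_between :: "step list \<Rightarrow> nat \<Rightarrow> nat \<Rightarrow> (nat \<times> nat) tree list" where
  "forest_between p i k =
     (if i < k \<and> i < partner p i \<and> partner p i < k
      then Node (i, partner p i) (forest_between p (Suc i) (partner p i))
             # forest_between p (Suc (partner p i)) k
      else [])"
  by pat_completeness auto
termination
  by (relation "Wellfounded.measure (\<lambda>(p, i, k). k - i)") auto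

declare forest_between.simps [simp del]

definition plane_forest :: "step list \<Rightarrow> (nat \<times> nat) tree list" where
  "plane_forest p = forest_between p 0 (length p)"

fun tree_increasing :: "('a \<Rightarrow> nat) \<Rightarrow> 'a tree \<Rightarrow> bool" where
  "tree_increasing L (Node v ts) \<longleftrightarrow> (\<forall>t \<in> set ts. L v < L (vertex t) \<and> tree_increasing L t)"

definition increasing_labeling :: "nat \<Rightarrow> 'a tree list \<Rightarrow> ('a \<Rightarrow> nat) \<Rightarrow> bool" where
  "increasing_labeling n F L \<longleftrightarrow>
     bij_betw L (forest_vertices F) {1..n} \<and> (\<forall>t \<in> set F. tree_increasing L t)"

definition pre :: "'a tree list \<Rightarrow> ('a \<Rightarrow> nat) \<Rightarrow> nat list" where
  "pre F L = map L (forest_preorder F)"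

definition post :: "'a tree list \<Rightarrow> ('a \<Rightarrow> nat) \<Rightarrow> nat list" where
  "post F L = map L (forest_postorder F)"

section \<open>Permutations in one-line notation\<close>

abbreviation perms :: "nat \<Rightarrow> nat list set" where
  "perms n \<equiv> permutations_of_set {1..n}"

definition inversions :: "nat list \<Rightarrow> nat" where
  "inversions w = card {(i, j). i < j \<and> j < length w \<and> w ! i > w ! j}"

definition left_weak_cover :: "nat \<Rightarrow> nat list \<Rightarrow> nat list \<Rightarrow> bool" where
  "left_weak_cover n v w \<longleftrightarrow> v \<in> perms n \<and>
     (\<exists>i \<in> {1..<n}. w = map (transpose i (i + 1)) v \<and> inversions w = inversions v + 1)"

definition left_weak_le :: "nat \<Rightarrow> nat list \<Rightarrow> nat list \<Rightarrow> bool" where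
  "left_weak_le n = (left_weak_cover n)\<^sup>*\<^sup>*"

section \<open>Consistency of the definitions\<close>

lemma point_sum: "k \<le> length p \<Longrightarrow> fst (point p k) + snd (point p k) = int k"
proof -
  have "count_list xs Down + count_list xs Up = length xs" for xs :: "step list"
  proof (induction xs)
    case (Cons s xs) then show ?case by (cases s) auto
  qed simp
  from this[of "take k p"] show "k \<le> length p \<Longrightarrow> ?thesis" by (auto simp: point_def)
qed

lemma card_points: "card (points p) = Suc (length p)"
proof -
  have "inj_on (point p) {..length p}"
  proof (rule inj_onI)
    fix k l assume "k \<in> {..length p}" "l \<in> {..length p}" "point p k = point p l"
    then have "int k = int l" by (metis atMost_iff point_sum)
    then show "k = l" by simp
  qed
  then show ?thesis by (simp add: points_def card_image)
qed

lemma finite_points: "finite (points p)"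
  by (simp add: points_def)

lemma dyck_tile_finite_odd:
  assumes "dyck_tile t"
  shows "finite t" "odd (card t)"
proof -
  obtain m p a b where p: "dyck_path m p" and t: "t = (\<lambda>(x, y). (a + x, b + y)) ` points p"
    using assms by (auto simp: dyck_tile_def)
  have "inj_on (\<lambda>(x, y). (a + x, b + y)) (points p)" by (auto simp: inj_on_def)
  then have "card t = Suc (length p)" using t by (simp add: card_image card_points)
  then show "odd (card t)" using p by (simp add: dyck_path_def)
  show "finite t" using t finite_points by simp
qed

lemma finite_region: "finite (region lam mu)"
proof -
  have "region lam mu \<subseteq> {-1..int (length lam)} \<times> {-1..int (length mu)}"
  proof
    fix c assume "c \<in> region lam mu"
    then obtain k l where k: "k \<le> length lam" "fst c + 1 \<le> fst (point lam k)" "snd (point lam k) \<le> snd c"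
      and l: "l \<le> length mu" "fst (point mu l) \<le> fst c" "snd c + 1 \<le> snd (point mu l)"
      by (auto simp: region_def cell_above_def cell_below_def points_def split_beta)
    have nn: "0 \<le> fst (point q j)" "0 \<le> snd (point q j)" for q j by (auto simp: point_def)
    have "fst c \<le> int (length lam)" "snd c \<le> int (length mu)"
      using k(1,2) l(1,3) point_sum[OF k(1)] point_sum[OF l(1)] nn[of lam k] nn[of mu l] by linarith+
    moreover have "0 \<le> fst c" "0 \<le> snd c" using k(3) l(2) nn[of lam k] nn[of mu l] by linarith+
    ultimately show "c \<in> {-1..int (length lam)} \<times> {-1..int (length mu)}" by (cases c) auto
  qed
  then show ?thesis by (rule finite_subset) auto
qed

lemma finite_dyck_tilings: "finite (dyck_tilings n lam)"
proof -
  let ?M = "{mu. set mu \<subseteq> {Up, Down} \<and> length mu = 2 * n}"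
  have "finite ?M" by (rule finite_lists_length_eq) simp
  then have "finite (Sigma ?M (\<lambda>mu. Pow (Pow (region lam mu))))"
    by (rule finite_SigmaI) (simp add: finite_region)
  moreover have "set mu \<subseteq> {Up, Down}" for mu :: "step list"
  proof
    fix s show "s \<in> {Up, Down}" by (cases s) auto
  qed
  then have "dyck_tilings n lam \<subseteq> Sigma ?M (\<lambda>mu. Pow (Pow (region lam mu)))"
    by (auto simp: dyck_tilings_def dyck_path_def dyck_tiling_def)
  ultimately show ?thesis by (rule rev_finite_subset)
qed

lemma even_area_plus_tiles:
  assumes "T \<in> dyck_tilings n lam"
  shows "even (area lam T + tiles T)"
proof -
  obtain mu D where T: "T = (mu, D)" by (cases T)
  have D: "\<And>t. t \<in> D \<Longrightarrow> dyck_tile t" "disjoint D" "\<Union>D = region lam mu"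
    using assms T by (auto simp: dyck_tilings_def dyck_tiling_def)
  have "finite D" using D(3) finite_region[of lam mu] finite_UnionD by metis
  have "card (region lam mu) = (\<Sum>t\<in>D. card t)"
    using card_Union_disjoint[of D] D dyck_tile_finite_odd(1) by (simp add: disjoint_def pairwise_def disjnt_def)
  moreover have "even ((\<Sum>t\<in>D. card t) + card D)"
  proof -
    have "(\<Sum>t\<in>D. card t) + card D = (\<Sum>t\<in>D. card t + 1)" unfolding sum.distrib by simp
    moreover have "even (\<Sum>t\<in>D. card t + 1)"
      using D(1) dyck_tile_finite_odd(2) by (intro dvd_sum) auto
    ultimately show ?thesis by simp
  qed
  ultimately show ?thesis by (simp add: T area_def tiles_def)
qed

text \<open>The recursive construction yields the plane forest as it should be: the vertices are the
  matched pairs, and the descendants of a vertex are the pairs nested inside it.\<close>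

definition height :: "step list \<Rightarrow> nat \<Rightarrow> int" where
  "height p k = snd (point p k) - fst (point p k)"

definition dyck_segment :: "step list \<Rightarrow> nat \<Rightarrow> nat \<Rightarrow> bool" where
  "dyck_segment p i k \<longleftrightarrow> i \<le> k \<and> k \<le> length p \<and> height p k = height p i \<and>
     (\<forall>l \<in> {i..k}. height p i \<le> height p l)"

lemma height_Suc:
  "k < length p \<Longrightarrow> height p (Suc k) = height p k + (if p ! k = Up then 1 else -1)"
  by (cases "p ! k") (auto simp: height_def point_def take_Suc_conv_app_nth)

lemma height_segment:
  assumes "i \<le> k" "k \<le> length p" "l \<le> k - i"
  shows "height (take (k - i) (drop i p)) l = height p (i + l) - height p i"
proof -
  have "take (i + l) p = take i p @ take l (take (k - i) (drop i p))"
    using assms by (simp add: take_add min_def)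
  then show ?thesis by (simp add: height_def point_def)
qed

lemma dyck_path_height:
  "(\<exists>m. dyck_path m p) \<longleftrightarrow> height p (length p) = 0 \<and> (\<forall>l \<le> length p. 0 \<le> height p l)"
  (is "?A \<longleftrightarrow> ?B")
proof
  assume ?A then show ?B by (auto simp: dyck_path_def points_def height_def split_beta)
next
  assume B: ?B
  define m where "m = count_list p Up"
  have "snd (point p (length p)) = int m" by (simp add: point_def m_def)
  moreover have "fst (point p (length p)) = int m"
    using B calculation by (simp add: height_def)
  moreover have "length p = 2 * m"
    using point_sum[of "length p" p] calculation by simp
  ultimately have "dyck_path m p"
    using B by (auto simp: dyck_path_def points_def height_def split_beta prod_eq_iff)
  then show ?A ..
qed

lemma dyck_segment_iff:
  assumes "i \<le> k" "k \<le> length p"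
  shows "(\<exists>m. dyck_path m (take (k - i) (drop i p))) \<longleftrightarrow> dyck_segment p i k"
proof -
  have len: "length (take (k - i) (drop i p)) = k - i" using assms by simp
  have "(\<forall>l \<le> k - i. 0 \<le> height (take (k - i) (drop i p)) l) \<longleftrightarrow>
        (\<forall>l \<in> {i..k}. height p i \<le> height p l)"
  proof (intro iffI ballI allI impI)
    fix l assume A: "\<forall>l \<le> k - i. 0 \<le> height (take (k - i) (drop i p)) l" and l: "l \<in> {i..k}"
    have le: "l - i \<le> k - i" using l by (simp add: diff_le_mono)
    with A have "0 \<le> height (take (k - i) (drop i p)) (l - i)" by blast
    then show "height p i \<le> height p l"
      using height_segment[OF assms le] l by simp
  next
    fix l assume "\<forall>l \<in> {i..k}. height p i \<le> height p l" "l \<le> k - i"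
    then show "0 \<le> height (take (k - i) (drop i p)) l"
      using height_segment[OF assms, of l] assms by auto
  qed
  moreover have "height (take (k - i) (drop i p)) (k - i) = height p k - height p i"
    using height_segment[OF assms, of "k - i"] assms by simp
  ultimately show ?thesis
    unfolding dyck_path_height len dyck_segment_def using assms by auto
qed

lemma matched_iff:
  "matched p i j \<longleftrightarrow> i < j \<and> j < length p \<and> p ! i = Up \<and> p ! j = Down \<and> dyck_segment p (Suc i) j"
  unfolding matched_def using dyck_segment_iff[of "Suc i" j p] by (metis Suc_leI less_imp_le_nat)

lemma matched_height:
  assumes "matched p i j"
  shows "height p (Suc j) = height p i"
    and "\<And>l. i < l \<Longrightarrow> l \<le> j \<Longrightarrow> height p i < height p l"
proof -
  have "i < j" "j < length p" "p ! i = Up" "p ! j = Down"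
    and d: "height p j = height p (Suc i)" "\<And>l. Suc i \<le> l \<Longrightarrow> l \<le> j \<Longrightarrow> height p (Suc i) \<le> height p l"
    using assms by (auto simp: matched_iff dyck_segment_def)
  then have h: "height p (Suc i) = height p i + 1" "height p (Suc j) = height p j - 1"
    using height_Suc[of i p] height_Suc[of j p] by auto
  then show "height p (Suc j) = height p i" using d(1) by simp
  show "height p i < height p l" if "i < l" "l \<le> j" for l
    using d(2)[of l] that h(1) by simp
qed

lemma matched_unique: "matched p i j \<Longrightarrow> matched p i j' \<Longrightarrow> j = j'"
proof -
  have "\<not> j < j'" if "matched p i j" "matched p i j'" for j j'
    using matched_height(1)[OF that(1)] matched_height(2)[OF that(2), of "Suc j"] that(1)
    by (auto simp: matched_iff)
  then show "matched p i j \<Longrightarrow> matched p i j' \<Longrightarrow> j = j'" by (meson linorder_neqE_nat)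
qed

lemma dyck_segment_partner:
  assumes "dyck_segment p i k" "i < k"
  shows "matched p i (partner p i)" "partner p i < k"
    "dyck_segment p (Suc i) (partner p i)" "dyck_segment p (Suc (partner p i)) k"
proof -
  define P where "P l \<longleftrightarrow> i < l \<and> height p l = height p i" for l
  define l where "l = Least P"
  have "P k" using assms by (simp add: P_def dyck_segment_def)
  then have "P l" and lk: "l \<le> k" unfolding l_def by (rule LeastI, rule Least_le)
  then have l: "i < l" "height p l = height p i" by (simp_all add: P_def)
  have k: "k \<le> length p" "height p k = height p i"
    and above: "\<And>r. i \<le> r \<Longrightarrow> r \<le> k \<Longrightarrow> height p i \<le> height p r"
    using assms(1) by (auto simp: dyck_segment_def)
  have gt: "height p i < height p r" if "i < r" "r < l" for r
  proof -
    have "\<not> P r" using not_less_Least that(2) unfolding l_def by blast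
    moreover have "height p i \<le> height p r" using above that lk by simp
    ultimately show ?thesis using that(1) by (simp add: P_def)
  qed
  obtain j where j: "l = Suc j" using l(1) by (cases l) auto
  have len: "i < length p" "j < length p" using l(1) lk k(1) j by simp_all
  have "height p i \<le> height p (Suc i)" using above assms(2) by simp
  then have up: "p ! i = Up" and hi: "height p (Suc i) = height p i + 1"
    using height_Suc[OF len(1)] by (auto split: if_splits)
  have "i \<noteq> j" using l(2) hi j by auto
  then have ij: "i < j" using l(1) j by simp
  have "height p i < height p j" using gt ij j by simp
  then have down: "p ! j = Down" and hj: "height p j = height p i + 1"
    using height_Suc[OF len(2)] l(2) j by (cases "p ! j"; simp)+
  have seg: "dyck_segment p (Suc i) j"
    unfolding dyck_segment_def
  proof (intro conjI ballI)
    show "height p (Suc i) \<le> height p r" if "r \<in> {Suc i..j}" for r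
      using gt[of r] that j hi by simp
  qed (use ij len hi hj in simp_all)
  then have m: "matched p i j" using ij len up down by (simp add: matched_iff)
  then have pj: "partner p i = j" unfolding partner_def using matched_unique by blast
  show "matched p i (partner p i)" "dyck_segment p (Suc i) (partner p i)"
    using m seg pj by simp_all
  show "partner p i < k" using pj j lk by simp
  show "dyck_segment p (Suc (partner p i)) k"
    unfolding pj dyck_segment_def
  proof (intro conjI ballI)
    show "height p (Suc j) \<le> height p r" if "r \<in> {Suc j..k}" for r
      using above[of r] that l(2) ij j by simp
  qed (use j lk l k in simp_all)
qed

lemma forest_between_unfold:
  assumes "dyck_segment p i k"
  shows "forest_between p i k = (if i < k
    then Node (i, partner p i) (forest_between p (Suc i) (partner p i))
           # forest_between p (Suc (partner p i)) k
    else [])"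
  using dyck_segment_partner[OF assms]
  by (subst forest_between.simps) (auto simp: matched_iff)

lemma forest_between_vertices:
  "dyck_segment p i k \<Longrightarrow>
     forest_vertices (forest_between p i k) = {(a, b). matched p a b \<and> i \<le> a \<and> b < k}"
proof (induction p i k rule: forest_between.induct)
  case (1 p i k)
  show ?case
  proof (cases "i < k")
    case False
    then show ?thesis using 1(3)
      by (auto simp: forest_between_unfold forest_vertices_def forest_preorder_def matched_iff)
  next
    case True
    define j where "j = partner p i"
    note s = dyck_segment_partner[OF 1(3) True, folded j_def]
    have ij: "i < j" using s(1) by (simp add: matched_iff)
    have IH: "forest_vertices (forest_between p (Suc i) j)
          = {(a, b). matched p a b \<and> Suc i \<le> a \<and> b < j}"
      "forest_vertices (forest_between p (Suc j) k)
          = {(a, b). matched p a b \<and> Suc j \<le> a \<and> b < k}"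
      using 1(1,2) True ij s by (simp_all add: j_def)
    have cross: "(a, b) = (i, j) \<or> Suc i \<le> a \<and> b < j \<or> Suc j \<le> a"
      if m: "matched p a b" and "i \<le> a" for a b
    proof -
      consider "a = i" | "a = j" | "i < a" "a < j" | "j < a" using \<open>i \<le> a\<close> by linarith
      then show ?thesis
      proof cases
        case 1 then show ?thesis using matched_unique[OF m] s(1) by auto
      next
        case 2 then show ?thesis using m s(1) by (auto simp: matched_iff)
      next
        case 3
        have "height p i < height p a" using matched_height(2)[OF s(1), of a] 3 by simp
        then have "b < j"
          using matched_height[OF m] matched_height(1)[OF s(1)] 3
          by (metis Suc_leI le_neq_implies_less less_SucI not_le order.asym)
        then show ?thesis using 3 by simp
      qed auto
    qed
    have "forest_vertices (forest_between p i k) =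
        insert (i, j) (forest_vertices (forest_between p (Suc i) j)
          \<union> forest_vertices (forest_between p (Suc j) k))"
      using True 1(3)
      by (simp add: forest_between_unfold[of p i k] forest_vertices_def forest_preorder_def j_def)
    also have "\<dots> = {(a, b). matched p a b \<and> i \<le> a \<and> b < k}"
      unfolding IH using s(1,2) ij cross by (fastforce simp: matched_iff)
    finally show ?thesis .
  qed
qed

lemma plane_forest_vertices:
  assumes "dyck_path n p"
  shows "forest_vertices (plane_forest p) = {(i, j). matched p i j}"
proof -
  have "dyck_segment p 0 (length p)"
    using dyck_segment_iff[of 0 "length p" p] assms by auto
  then show ?thesis
    unfolding plane_forest_def by (subst forest_between_vertices) (auto simp: matched_iff)
qed

inductive subtree :: "'a tree list \<Rightarrow> 'a tree \<Rightarrow> bool" for F where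
  "t \<in> set F \<Longrightarrow> subtree F t"
| "subtree F (Node v ts) \<Longrightarrow> t \<in> set ts \<Longrightarrow> subtree F t"

lemma forest_between_members:
  "dyck_segment p i k \<Longrightarrow> t \<in> set (forest_between p i k) \<Longrightarrow>
     \<exists>a b. matched p a b \<and> t = Node (a, b) (forest_between p (Suc a) b)"
proof (induction p i k rule: forest_between.induct)
  case (1 p i k)
  show ?case
  proof (cases "i < k")
    case True
    note s = dyck_segment_partner[OF 1(3) True]
    have "t = Node (i, partner p i) (forest_between p (Suc i) (partner p i)) \<or>
        t \<in> set (forest_between p (Suc (partner p i)) k)"
      using 1(3,4) True by (simp add: forest_between_unfold[of p i k])
    then show ?thesis using 1(2) s True by (auto simp: matched_iff)
  qed (use 1 in \<open>simp add: forest_between_unfold\<close>)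
qed

lemma plane_forest_descendants:
  assumes "dyck_path n p" "subtree (plane_forest p) (Node (a, b) ts)"
  shows "forest_vertices ts = {(a', b'). matched p a' b' \<and> a < a' \<and> b' < b}"
proof -
  have p: "dyck_segment p 0 (length p)"
    using dyck_segment_iff[of 0 "length p" p] assms(1) by auto
  have "\<exists>a b. matched p a b \<and> t = Node (a, b) (forest_between p (Suc a) b)"
    if "subtree (plane_forest p) t" for t
    using that
  proof induction
    case (1 t)
    then show ?case using forest_between_members[OF p] by (simp add: plane_forest_def)
  next
    case (2 v ts t)
    then obtain a b where m: "matched p a b" and "ts = forest_between p (Suc a) b" by blast
    then have "t \<in> set (forest_between p (Suc a) b)" using 2 by simp
    moreover have "dyck_segment p (Suc a) b" using m by (simp add: matched_iff)
    ultimately show ?case using forest_between_members by blast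
  qed
  from this[OF assms(2)] have m: "matched p a b" and ts: "ts = forest_between p (Suc a) b" by simp_all
  have "dyck_segment p (Suc a) b" using m by (simp add: matched_iff)
  then show ?thesis unfolding ts by (subst forest_between_vertices) (auto simp: Suc_le_eq)
qed

end

theory Submission
  imports Defs
begin

text \<open>
  Both sides of the theorem are computed from the plane forest \<open>F\<close>, by two recursions that turn out to
  be the same.

  \<^emph>\<open>Tilings.\<close>  Index a cell by its column (the antidiagonal through its center) and its level (its
  height above \<open>lam\<close> within the column).  Cover-inclusiveness forces every tile to stay at one
  level and to run parallel to a piece of \<open>lam\<close> that is itself a translated Dyck path
  (\<open>tile_eq_strip\<close>): the tiles at level 0 have nothing but \<open>lam\<close> below them, and a tile at level
  \<open>k + 1\<close> copies a part of a tile at level \<open>k\<close>.  A tiling is therefore determined by two functions: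
  the number of levels \<open>m c\<close> of each column \<open>c\<close>, and the number \<open>f s\<close> of levels at which a tile
  crosses the step \<open>s\<close> of \<open>lam\<close>.  Since a piece of \<open>lam\<close> forming a Dyck path contains with a step
  its partner and everything between, \<open>f\<close> takes equal values on matched steps and can only grow
  towards nested steps.  Conversely all such pairs, called fillings below, with the evident local
  conditions come from tilings, and \<open>art\<close> is the sum of \<open>m\<close> over the columns minus the sum of \<open>f\<close>
  over the up steps.

  Read along the path from right to left, the generating function of fillings is produced by an
  operator on functions of the current number of levels (\<open>filling_gf_forest\<close>).  The operator of a
  forest is the composite of those of its trees, and the operator of a tree is obtained from that of
  the forest below its root by \<open>tree_op\<close>.  The heart of the matter is that for a forest with \<open>n\<close>
  vertices this operator is a scalar multiple of the \<open>n\<close>-th power of the operator \<open>peak_op\<close> of a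
  single peak.  For concatenation this is clear; for the root of a tree it is the identity
  \<open>tree_op_peaks\<close>, which follows from three commutation relations between simple operators.

  \<^emph>\<open>Permutations.\<close>  One has \<open>pi0 \<le>\<^sub>L w\<close> iff the positions of inversions of \<open>pi0\<close> are among those of
  \<open>w\<close> (\<open>left_weak_le_iff\<close>).  In \<open>pi0\<close> the inverted pairs are the pairs of a descendant and an
  ancestor, so the \<open>w\<close> above \<open>pi0\<close> are the post-order words of increasing labelings.  Splitting off the
  first tree amounts to distributing the letters between two words, with the same factor as for all
  permutations (\<open>sum_cross_inversions\<close>); a root carries the least letter of its tree.

  Both recursions keep the two sides in the ratio required (\<open>forest_op_above_gf\<close>), and evaluating the
  operators at level 0 gives the theorem.
\<close>

section \<open>q-numbers and transfer operators\<close>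

definition q :: "int poly" where "q = monom 1 1"

definition qnum :: "nat \<Rightarrow> int poly" where "qnum n = (\<Sum>i<n. q ^ i)"

lemma qnum_0 [simp]: "qnum 0 = 0" by (simp add: qnum_def)

lemma qnum_Suc: "qnum (Suc n) = 1 + q * qnum n"
  unfolding qnum_def by (subst sum.lessThan_Suc_shift) (simp add: sum_distrib_left)

lemma qnum_Suc': "qnum (Suc n) = qnum n + q ^ n"
  by (simp add: qnum_def)

text \<open>Let \<open>f z\<close> be the generating function of the part of a path after some point where there are \<open>z\<close> levels
  of cells.  A preceding down step may keep the number \<open>x\<close> of levels or raise it by one, and the column
  it enters contributes as many cells as it has levels.\<close>

definition down_op :: "(nat \<Rightarrow> int poly) \<Rightarrow> nat \<Rightarrow> int poly" where
  "down_op f x = q ^ x * f x + q ^ Suc x * f (Suc x)"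

text \<open>The contribution to \<open>peak_op\<close> of an up step that lowers the number of levels.  At level 0 there is no
  such step, whence the value 0.\<close>

definition shifted_down_op :: "(nat \<Rightarrow> int poly) \<Rightarrow> nat \<Rightarrow> int poly" where
  "shifted_down_op f x = (case x of 0 \<Rightarrow> 0 | Suc y \<Rightarrow> qnum (Suc y) * down_op f y)"

text \<open>The operator of an up step followed by a down step.  The up step keeps the number of levels or lowers
  it by one, which gives the two summands.  If \<open>z\<close> levels remain at the peak, the factor
  \<open>qnum (Suc z)\<close> is the sum of \<open>q ^ (z - a)\<close> over the possible numbers \<open>a \<le> z\<close> of tiles crossing the peak.  That it equals \<open>tree_op\<close> of the
  identity is the case \<open>n = 0\<close> of \<open>tree_op_peaks\<close>.\<close>

definition peak_op :: "(nat \<Rightarrow> int poly) \<Rightarrow> nat \<Rightarrow> int poly" where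
  "peak_op f x = qnum (Suc x) * down_op f x + shifted_down_op f x"

lemma down_op_linear:
  "down_op (\<lambda>x. c * f x) = (\<lambda>x. c * down_op f x)" "down_op (\<lambda>x. f x + g x) = (\<lambda>x. down_op f x + down_op g x)"
  by (auto simp: down_op_def algebra_simps)

lemma shifted_down_op_linear:
  "shifted_down_op (\<lambda>x. c * f x) = (\<lambda>x. c * shifted_down_op f x)"
  "shifted_down_op (\<lambda>x. f x + g x) = (\<lambda>x. shifted_down_op f x + shifted_down_op g x)"
  by (auto simp: shifted_down_op_def down_op_linear algebra_simps split: nat.splits)

lemma peak_op_linear:
  "peak_op (\<lambda>x. c * f x) = (\<lambda>x. c * peak_op f x)" "peak_op (\<lambda>x. f x + g x) = (\<lambda>x. peak_op f x + peak_op g x)"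
  by (auto simp: peak_op_def down_op_linear shifted_down_op_linear algebra_simps)

lemma peaks_linear:
  "(peak_op ^^ n) (\<lambda>x. c * f x) = (\<lambda>x. c * (peak_op ^^ n) f x)"
  "(peak_op ^^ n) (\<lambda>x. f x + g x) = (\<lambda>x. (peak_op ^^ n) f x + (peak_op ^^ n) g x)"
  by (induction n) (auto simp: peak_op_linear)

text \<open>The commutation relations.  With \<open>A = down_op\<close>, \<open>P = peak_op\<close> and \<open>S f = (\<lambda>y. f (Suc y))\<close>, this lemma and
  the next two say \<open>S A = q A S\<close>, \<open>A P = q P A + A A\<close> and \<open>S P = q P S + A A\<close>.  Thus \<open>A\<close> and \<open>S\<close> move past \<open>P\<close>
  with the same correction term.\<close>

lemma down_op_shift: "down_op f (Suc x) = q * down_op (\<lambda>y. f (Suc y)) x"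
  by (simp add: down_op_def algebra_simps)

lemma down_op_peak_op: "down_op (peak_op f) = (\<lambda>x. q * peak_op (down_op f) x + down_op (down_op f) x)"
proof
  fix x show "down_op (peak_op f) x = q * peak_op (down_op f) x + down_op (down_op f) x"
    by (cases x) (simp_all add: peak_op_def shifted_down_op_def down_op_def qnum_Suc algebra_simps)
qed

lemma peak_op_shift: "(\<lambda>x. peak_op f (Suc x)) = (\<lambda>x. q * peak_op (\<lambda>y. f (Suc y)) x + down_op (down_op f) x)"
proof
  fix x show "peak_op f (Suc x) = q * peak_op (\<lambda>y. f (Suc y)) x + down_op (down_op f) x"
  proof (cases x)
    case 0 then show ?thesis by (simp add: peak_op_def shifted_down_op_def down_op_def qnum_Suc algebra_simps)
  next
    case (Suc y)
    then show ?thesis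
      by (simp add: peak_op_def shifted_down_op_def down_op_def qnum_Suc' algebra_simps)
  qed
qed

text \<open>Moving one factor \<open>peak_op\<close> through the others with \<open>A P = q P A + A A\<close> produces the term \<open>A A\<close>; the induction
  hypothesis, applied to \<open>A f\<close>, turns exactly these terms back into a power of \<open>peak_op\<close>, and
  \<open>qnum (n + 2) = 1 + q * qnum (n + 1)\<close> collects the result.\<close>

lemma peaks_down_op:
  "q ^ x * (peak_op ^^ Suc n) f x
     = qnum (Suc n) * (q ^ x * (peak_op ^^ n) (down_op f) x)
       + q ^ Suc n * shifted_down_op ((peak_op ^^ n) (down_op f)) x"
proof (induction n arbitrary: f x)
  case 0
  show ?case
    by (cases x) (simp_all add: peak_op_def shifted_down_op_def down_op_def qnum_Suc algebra_simps)
next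
  case (Suc n)
  have c: "(peak_op ^^ n) (down_op (peak_op f)) = (\<lambda>x. q * (peak_op ^^ Suc n) (down_op f) x + (peak_op ^^ n) (down_op (down_op f)) x)"
    unfolding down_op_peak_op peaks_linear by (simp add: funpow_swap1)
  have "q ^ x * (peak_op ^^ Suc (Suc n)) f x = q ^ x * (peak_op ^^ Suc n) (peak_op f) x"
    by (simp add: funpow_swap1)
  also have "\<dots> = q * qnum (Suc n) * q ^ x * (peak_op ^^ Suc n) (down_op f) x
       + q ^ Suc (Suc n) * shifted_down_op ((peak_op ^^ Suc n) (down_op f)) x
       + (qnum (Suc n) * (q ^ x * (peak_op ^^ n) (down_op (down_op f)) x)
       + q ^ Suc n * shifted_down_op ((peak_op ^^ n) (down_op (down_op f))) x)"
    unfolding Suc.IH c shifted_down_op_linear by (simp add: algebra_simps)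
  also have "\<dots> = q * qnum (Suc n) * q ^ x * (peak_op ^^ Suc n) (down_op f) x
       + q ^ Suc (Suc n) * shifted_down_op ((peak_op ^^ Suc n) (down_op f)) x
       + q ^ x * (peak_op ^^ Suc n) (down_op f) x"
    unfolding Suc.IH[of x "down_op f"] ..
  finally show ?case by (subst qnum_Suc) (simp add: algebra_simps)
qed

text \<open>The same argument, with \<open>S\<close> in place of one \<open>A\<close>: the correction terms of the two commutations are
  equal, so that \<open>peaks_down_op\<close> sums them up.\<close>

lemma down_op_peaks:
  "qnum (Suc x) * down_op ((peak_op ^^ n) f) x
     = qnum (Suc n) * (q ^ x * (peak_op ^^ n) (down_op f) x)
       + q ^ Suc n * shifted_down_op ((peak_op ^^ n) (\<lambda>y. f (Suc y))) x"
proof (induction n arbitrary: f x)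
  case 0
  show ?case
    by (cases x) (simp_all add: shifted_down_op_def down_op_def qnum_Suc' algebra_simps)
next
  case (Suc n)
  have c: "(peak_op ^^ n) (down_op (peak_op f)) = (\<lambda>x. q * (peak_op ^^ Suc n) (down_op f) x + (peak_op ^^ n) (down_op (down_op f)) x)"
    unfolding down_op_peak_op peaks_linear by (simp add: funpow_swap1)
  have d: "(peak_op ^^ n) (\<lambda>y. peak_op f (Suc y))
      = (\<lambda>x. q * (peak_op ^^ Suc n) (\<lambda>y. f (Suc y)) x + (peak_op ^^ n) (down_op (down_op f)) x)"
    unfolding peak_op_shift peaks_linear by (simp add: funpow_swap1)
  have "qnum (Suc x) * down_op ((peak_op ^^ Suc n) f) x = qnum (Suc x) * down_op ((peak_op ^^ n) (peak_op f)) x"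
    by (simp add: funpow_swap1)
  also have "\<dots> = q * qnum (Suc n) * q ^ x * (peak_op ^^ Suc n) (down_op f) x
       + q ^ Suc (Suc n) * shifted_down_op ((peak_op ^^ Suc n) (\<lambda>y. f (Suc y))) x
       + (qnum (Suc n) * (q ^ x * (peak_op ^^ n) (down_op (down_op f)) x)
       + q ^ Suc n * shifted_down_op ((peak_op ^^ n) (down_op (down_op f))) x)"
    unfolding Suc.IH c d shifted_down_op_linear by (simp add: algebra_simps)
  also have "\<dots> = q * qnum (Suc n) * q ^ x * (peak_op ^^ Suc n) (down_op f) x
       + q ^ Suc (Suc n) * shifted_down_op ((peak_op ^^ Suc n) (\<lambda>y. f (Suc y))) x
       + q ^ x * (peak_op ^^ Suc n) (down_op f) x"
    unfolding peaks_down_op[of x n "down_op f"] ..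
  finally show ?case by (subst (2) qnum_Suc) (simp add: algebra_simps)
qed

text \<open>Suppose that \<open>Q\<close> is the operator of a forest with \<open>n\<close> vertices.  If \<open>a\<close> tiles cross the root above it, then
  the lowest \<open>a\<close> levels over the whole forest are filled by these tiles, and what remains is a
  filling of the forest with all levels lowered by \<open>a\<close>.  Each of the \<open>2 * n\<close> columns of the forest
  after the first then loses \<open>a\<close> cells, and each of its \<open>n\<close> up steps \<open>a\<close> crossings, whence the factor
  \<open>q ^ (a * n)\<close>; the remaining \<open>z - a\<close> is the weight of the up step of the root.\<close>

definition crossing_sum :: "nat \<Rightarrow> ((nat \<Rightarrow> int poly) \<Rightarrow> nat \<Rightarrow> int poly) \<Rightarrow> (nat \<Rightarrow> int poly) \<Rightarrow> nat \<Rightarrow> int poly"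
  where "crossing_sum n Q g z = (\<Sum>a\<le>z. q ^ (z - a + a * n) * Q (\<lambda>w. g (w + a)) (z - a))"

text \<open>The up step of the root leads from \<open>x\<close> to \<open>z\<close> levels; \<open>down_op\<close> accounts for its down step.\<close>

definition tree_op :: "nat \<Rightarrow> ((nat \<Rightarrow> int poly) \<Rightarrow> nat \<Rightarrow> int poly) \<Rightarrow> (nat \<Rightarrow> int poly) \<Rightarrow> nat \<Rightarrow> int poly"
  where "tree_op n Q f x = (\<Sum>z\<in>{x - 1..x}. crossing_sum n Q (down_op f) z)"

lemma crossing_sum_Suc:
  "crossing_sum n Q g (Suc z) = q ^ Suc z * Q g (Suc z) + q ^ n * crossing_sum n Q (\<lambda>w. g (Suc w)) z"
proof -
  have "crossing_sum n Q g (Suc z) = q ^ Suc z * Q g (Suc z)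
      + (\<Sum>a\<le>z. q ^ (z - a + Suc a * n) * Q (\<lambda>w. g (w + Suc a)) (z - a))"
    unfolding crossing_sum_def by (subst sum.atMost_Suc_shift) simp
  moreover have "q ^ (z - a + Suc a * n) = q ^ n * q ^ (z - a + a * n)" for a
    by (simp flip: power_add add: algebra_simps)
  ultimately show ?thesis unfolding crossing_sum_def sum_distrib_left by (simp only: mult.assoc add_Suc_right)
qed

lemma crossing_sum_cmult:
  assumes "\<And>c f. Q (\<lambda>x. c * f x) = (\<lambda>x. c * Q f x)"
  shows "crossing_sum n Q (\<lambda>x. c * g x) = (\<lambda>x. c * crossing_sum n Q g x)"
  by (rule ext) (simp add: crossing_sum_def assms sum_distrib_left algebra_simps)

text \<open>The sum over the number of crossings obeys a recursion in the level \<open>z\<close> (\<open>crossing_sum_Suc\<close>), and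
  \<open>down_op_peaks\<close> says that the right-hand side obeys the same one.\<close>

lemma crossing_sum_peaks:
  "qnum (Suc n) * crossing_sum n (peak_op ^^ n) (down_op f) z = qnum (Suc z) * down_op ((peak_op ^^ n) f) z"
proof (induction z arbitrary: f)
  case 0
  show ?case unfolding down_op_peaks by (simp add: crossing_sum_def shifted_down_op_def)
next
  case (Suc z)
  have "(\<lambda>w. down_op f (Suc w)) = (\<lambda>w. q * down_op (\<lambda>y. f (Suc y)) w)"
    using down_op_shift by blast
  then have "crossing_sum n (peak_op ^^ n) (\<lambda>w. down_op f (Suc w)) z = q * crossing_sum n (peak_op ^^ n) (down_op (\<lambda>y. f (Suc y))) z"
    by (simp add: crossing_sum_cmult peaks_linear(1))
  then have "qnum (Suc n) * crossing_sum n (peak_op ^^ n) (down_op f) (Suc z)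
     = qnum (Suc n) * (q ^ Suc z * (peak_op ^^ n) (down_op f) (Suc z))
       + q ^ Suc n * (qnum (Suc n) * crossing_sum n (peak_op ^^ n) (down_op (\<lambda>y. f (Suc y))) z)"
    by (simp add: crossing_sum_Suc algebra_simps)
  then show ?case unfolding Suc.IH down_op_peaks[of "Suc z"] by (simp add: shifted_down_op_def)
qed

lemma tree_op_peaks: "qnum (Suc n) * tree_op n (peak_op ^^ n) f x = (peak_op ^^ Suc n) f x"
proof (cases x)
  case 0 then show ?thesis by (simp add: tree_op_def crossing_sum_peaks peak_op_def shifted_down_op_def)
next
  case (Suc y)
  have "{y..Suc y} = {y, Suc y}" by auto
  then show ?thesis using Suc 
   by (simp add: tree_op_def crossing_sum_peaks peak_op_def shifted_down_op_def distrib_left del: qnum_Suc)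
qed

definition qfact :: "nat \<Rightarrow> int poly" where "qfact n = (\<Prod>i<n. qnum (Suc i))"

text \<open>At level 0 the second summand of \<open>peaks_down_op\<close> vanishes, and \<open>down_op\<close> fixes the indicator function
  of 0.\<close>

lemma peaks_at_0: "(peak_op ^^ n) (\<lambda>x. if x = 0 then 1 else 0) 0 = qfact n"
proof (induction n)
  case 0 then show ?case by (simp add: qfact_def)
next
  case (Suc n)
  have r: "down_op (\<lambda>x. if x = 0 then 1 else 0) = (\<lambda>x. if x = 0 then 1 else 0)"
    by (auto simp: down_op_def)
  show ?case using peaks_down_op[of 0 n "\<lambda>x. if x = 0 then 1 else 0"] Suc 
    by (simp add: r shifted_down_op_def qfact_def mult.commute)
qed

fun word :: "'a tree list \<Rightarrow> step list" where
  "word [] = []"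
| "word (Node v ts # F) = Up # word ts @ Down # word F"

fun forest_op :: "'a tree list \<Rightarrow> (nat \<Rightarrow> int poly) \<Rightarrow> nat \<Rightarrow> int poly" where
  "forest_op [] f = f"
| "forest_op (Node v ts # F) f = tree_op (length (forest_preorder ts)) (forest_op ts) (forest_op F f)"

lemma forest_op_cmult: "forest_op F (\<lambda>x. c * f x) = (\<lambda>x. c * forest_op F f x)"
proof (induction F arbitrary: c f rule: word.induct[case_names Nil Cons])
  case (Cons v ts F)
  show ?case
    by (rule ext) (simp add: Cons tree_op_def down_op_linear crossing_sum_cmult sum_distrib_left)
qed simp

section \<open>Fillings of a path and their generating function\<close>

text \<open>A filling lists for every step of the path the number of tiles that cross it and the number of
  levels of the column after it; \<open>x\<close> is the number of levels of the column before the first step.  The list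
  \<open>st\<close> holds the crossing numbers of the up steps that are still open, innermost first.  An up step must be
  crossed at least as often as the step around it, and a down step as often as its partner, which
  lies on top.  The entry 0 at the bottom stands for the outside of the path.\<close>

fun filling :: "step list \<Rightarrow> nat list \<Rightarrow> nat \<Rightarrow> (nat \<times> nat) list \<Rightarrow> bool" where
  "filling [] st x [] \<longleftrightarrow> st = [0] \<and> x = 0"
| "filling (Up # p) (b # st) x ((a, z) # fl) \<longleftrightarrow>
     z \<in> {x - 1..x} \<and> a \<in> {b..z} \<and> filling p (a # b # st) z fl"
| "filling (Down # p) (b # st) x ((a, z) # fl) \<longleftrightarrow>
     z \<in> {x, Suc x} \<and> a = b \<and> b \<le> x \<and> filling p st z fl"
| "filling _ _ _ _ \<longleftrightarrow> False"

text \<open>Crossings are subtracted on up steps only, since on down steps they repeat.\<close>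

fun weight :: "step list \<Rightarrow> (nat \<times> nat) list \<Rightarrow> nat" where
  "weight (Up # p) ((a, z) # fl) = (z - a) + weight p fl"
| "weight (Down # p) ((a, z) # fl) = z + weight p fl"
| "weight _ _ = 0"

definition filling_gf :: "step list \<Rightarrow> nat list \<Rightarrow> nat \<Rightarrow> int poly" where
  "filling_gf p st x = (\<Sum>fl | filling p st x fl. q ^ weight p fl)"

lemma filling_Nil_iff: "filling [] st x fl \<longleftrightarrow> st = [0] \<and> x = 0 \<and> fl = []"
  by (cases fl) auto

lemma filling_Up_iff:
  "filling (Up # p) (b # st) x fl \<longleftrightarrow>
     (\<exists>a z fl'. fl = (a, z) # fl' \<and> z \<in> {x - 1..x} \<and> a \<in> {b..z} \<and> filling p (a # b # st) z fl')"
proof (cases fl)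
  case (Cons g fl') then show ?thesis by (cases g) auto
qed simp

lemma filling_Down_iff:
  "filling (Down # p) (b # st) x fl \<longleftrightarrow>
     (\<exists>z fl'. fl = (b, z) # fl' \<and> z \<in> {x, Suc x} \<and> b \<le> x \<and> filling p st z fl')"
proof (cases fl)
  case (Cons g fl') then show ?thesis by (cases g) auto
qed simp

lemma finite_fillings: "finite {fl. filling p st x fl}"
proof (induction p arbitrary: st x)
  case Nil
  show ?case by (simp add: filling_Nil_iff)
next
  case (Cons s p)
  show ?case
  proof (cases st)
    case Nil
    then have "{fl. filling (s # p) st x fl} = {}" by (cases s) auto
    then show ?thesis by simp
  next
    case st: (Cons b st')
    show ?thesis
    proof (cases s)
      case Up
      have "{fl. filling (Up # p) (b # st') x fl}
          \<subseteq> (\<Union>z\<in>{x - 1..x}. \<Union>a\<in>{b..z}. Cons (a, z) ` {fl. filling p (a # b # st') z fl})"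
      proof
        fix fl assume "fl \<in> {fl. filling (Up # p) (b # st') x fl}"
        then obtain a z fl' where "fl = (a, z) # fl'" "z \<in> {x - 1..x}" "a \<in> {b..z}"
            "filling p (a # b # st') z fl'"
          unfolding mem_Collect_eq filling_Up_iff by blast
        then show "fl \<in> (\<Union>z\<in>{x - 1..x}. \<Union>a\<in>{b..z}. Cons (a, z) ` {fl. filling p (a # b # st') z fl})"
          by (intro UN_I[of z] UN_I[of a] image_eqI[of _ _ fl']) simp_all
      qed
      then show ?thesis unfolding Up st by (rule finite_subset) (use Cons.IH in simp)
    next
      case Down
      have "{fl. filling (Down # p) (b # st') x fl}
          \<subseteq> (\<Union>z\<in>{x, Suc x}. Cons (b, z) ` {fl. filling p st' z fl})"
        by (auto simp: filling_Down_iff)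
      then show ?thesis unfolding Down st by (rule finite_subset) (use Cons.IH in simp)
    qed
  qed
qed

lemma filling_gf_Nil: "filling_gf [] st x = (if st = [0] \<and> x = 0 then 1 else 0)"
  by (simp add: filling_gf_def filling_Nil_iff)

lemma filling_gf_Up:
  "filling_gf (Up # p) (b # st) x
     = (\<Sum>z\<in>{x - 1..x}. \<Sum>a\<in>{b..z}. q ^ (z - a) * filling_gf p (a # b # st) z)"
proof -
  have "(\<Sum>z\<in>{x - 1..x}. \<Sum>a\<in>{b..z}. q ^ (z - a) * filling_gf p (a # b # st) z)
    = (\<Sum>(z, a, fl)\<in>Sigma {x - 1..x} (\<lambda>z. Sigma {b..z} (\<lambda>a. {fl. filling p (a # b # st) z fl})).
         q ^ (z - a + weight p fl))"
    unfolding filling_gf_def sum_distrib_left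
    by (simp add: sum.Sigma finite_fillings power_add)
  also have "\<dots> = (\<Sum>fl | filling (Up # p) (b # st) x fl. q ^ weight (Up # p) fl)"
    by (rule sum.reindex_bij_witness[of _ "\<lambda>fl. (snd (hd fl), fst (hd fl), tl fl)"
          "\<lambda>(z, a, fl). (a, z) # fl"])
      (auto simp: filling_Up_iff)
  finally show ?thesis by (simp add: filling_gf_def)
qed

lemma filling_gf_Down:
  "filling_gf (Down # p) (b # st) x
     = (if b \<le> x then \<Sum>z\<in>{x, Suc x}. q ^ z * filling_gf p st z else 0)"
proof (cases "b \<le> x")
  case True
  have "(\<Sum>z\<in>{x, Suc x}. q ^ z * filling_gf p st z)
    = (\<Sum>(z, fl)\<in>Sigma {x, Suc x} (\<lambda>z. {fl. filling p st z fl}). q ^ (z + weight p fl))"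
    unfolding filling_gf_def sum_distrib_left power_add[symmetric]
    by (subst sum.Sigma) (auto simp: finite_fillings)
  also have "\<dots> = (\<Sum>fl | filling (Down # p) (b # st) x fl. q ^ weight (Down # p) fl)"
    by (rule sum.reindex_bij_witness[of _ "\<lambda>fl. (snd (hd fl), tl fl)" "\<lambda>(z, fl). (b, z) # fl"])
      (use True in \<open>auto simp: filling_Down_iff\<close>)
  finally show ?thesis using True by (simp add: filling_gf_def)
next
  case False
  then have "{fl. filling (Down # p) (b # st) x fl} = {}" by (auto simp: filling_Down_iff)
  then show ?thesis using False by (simp only: filling_gf_def if_False sum.empty)
qed

abbreviation num_vertices :: "'a tree list \<Rightarrow> nat" where
  "num_vertices F \<equiv> length (forest_preorder F)"

text \<open>In the presence of an open step crossed \<open>b\<close> times, the lowest \<open>b\<close> levels over the forest are taken by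
  the tiles crossing that step.  Removing them leaves a filling of the forest alone and costs
  \<open>2 * b\<close> cells and \<open>b\<close> crossings for each vertex.\<close>

lemma filling_gf_forest:
  "b \<le> x \<Longrightarrow> filling_gf (word F @ r) (b # st) x
     = q ^ (b * num_vertices F) * forest_op F (\<lambda>w. filling_gf r (b # st) (w + b)) (x - b)"
proof (induction F arbitrary: b st x r rule: word.induct[case_names Nil Cons])
  case Nil
  then show ?case by (simp add: forest_preorder_def)
next
  case (Cons v ts F)
  define n m where "n = num_vertices ts" and "m = num_vertices F"
  have size: "num_vertices (Node v ts # F) = Suc (n + m)"
    by (simp add: n_def m_def forest_preorder_def)
  define h where "h = forest_op F (\<lambda>w. filling_gf r (b # st) (w + b))"
  \<comment> \<open>The down step of the root, followed by the rest of the forest.\<close>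
  have tail: "filling_gf (Down # word F @ r) (a # b # st) (w + a)
      = q ^ (b * m + b) * down_op h (w + (a - b))" if ba: "b \<le> a" for a w
  proof -
    obtain d where d: "a = b + d" using ba le_Suc_ex by blast
    have "filling_gf (word F @ r) (b # st) (b + y) = q ^ (b * m) * h y" for y
      using Cons.IH(2)[of b "b + y" r st] by (simp add: h_def m_def)
    note this[of "w + d"] this[of "Suc (w + d)"]
    moreover have "b + (w + d) = w + a" "b + Suc (w + d) = Suc (w + a)"
      by (simp_all add: d)
    ultimately have h: "filling_gf (word F @ r) (b # st) (w + a) = q ^ (b * m) * h (w + d)"
      "filling_gf (word F @ r) (b # st) (Suc (w + a)) = q ^ (b * m) * h (Suc (w + d))"
      by simp_all
    have p: "q ^ (w + a) = q ^ b * q ^ (w + d)" "q ^ Suc (w + a) = q ^ b * q ^ Suc (w + d)"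
      by (simp_all add: d power_add)
    have "filling_gf (Down # word F @ r) (a # b # st) (w + a)
        = q ^ (w + a) * filling_gf (word F @ r) (b # st) (w + a)
        + q ^ Suc (w + a) * filling_gf (word F @ r) (b # st) (Suc (w + a))"
      by (simp add: filling_gf_Down)
    also have "\<dots> = q ^ (b * m + b) * down_op h (w + d)"
      unfolding h p down_op_def by (simp only: power_add distrib_left mult.assoc mult.left_commute mult.commute)
    finally show ?thesis by (simp add: d)
  qed
  \<comment> \<open>The root is crossed \<open>a\<close> times; \<open>a - b\<close> is the summation index of \<open>crossing_sum\<close>.\<close>
  have inner: "(\<Sum>a\<in>{b..z}. q ^ (z - a) * filling_gf (word ts @ Down # word F @ r) (a # b # st) z)
      = (if b \<le> z then q ^ (b * Suc (n + m)) * crossing_sum n (forest_op ts) (down_op h) (z - b) else 0)" for z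
  proof (cases "b \<le> z")
    case True
    then obtain d where d: "z = b + d" using le_Suc_ex by blast
    have "q ^ (z - (b + a)) * filling_gf (word ts @ Down # word F @ r) ((b + a) # b # st) z
       = q ^ (b * Suc (n + m)) * (q ^ (d - a + a * n) * forest_op ts (\<lambda>w. down_op h (w + a)) (d - a))"
      if "a \<le> d" for a
    proof -
      have "filling_gf (word ts @ Down # word F @ r) ((b + a) # b # st) z
          = q ^ ((b + a) * n) * forest_op ts
              (\<lambda>w. filling_gf (Down # word F @ r) ((b + a) # b # st) (w + (b + a))) (z - (b + a))"
        unfolding n_def by (rule Cons.IH(1)) (use d that in simp)
      also have "\<dots> = q ^ ((b + a) * n) * (q ^ (b * m + b) * forest_op ts (\<lambda>w. down_op h (w + a)) (d - a))"
        by (subst tail) (simp_all add: forest_op_cmult d)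
      finally have "q ^ (z - (b + a)) * filling_gf (word ts @ Down # word F @ r) ((b + a) # b # st) z
          = q ^ (d - a + (b + a) * n + (b * m + b)) * forest_op ts (\<lambda>w. down_op h (w + a)) (d - a)"
        by (simp only: power_add mult.assoc) (simp add: d)
      moreover have "d - a + (b + a) * n + (b * m + b) = b * Suc (n + m) + (d - a + a * n)"
        by (simp add: algebra_simps)
      ultimately show ?thesis by (simp only: power_add mult.assoc)
    qed
    then have "(\<Sum>a\<in>{..d}. q ^ (z - (b + a)) * filling_gf (word ts @ Down # word F @ r) ((b + a) # b # st) z)
        = q ^ (b * Suc (n + m)) * crossing_sum n (forest_op ts) (down_op h) d"
      by (simp add: crossing_sum_def sum_distrib_left)
    moreover have "(\<Sum>a\<in>{..d}. q ^ (z - (b + a)) * filling_gf (word ts @ Down # word F @ r) ((b + a) # b # st) z)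
       = (\<Sum>a\<in>{b..z}. q ^ (z - a) * filling_gf (word ts @ Down # word F @ r) (a # b # st) z)"
      by (rule sum.reindex_bij_witness[of _ "\<lambda>a. a - b" "\<lambda>a. b + a"]) (auto simp: d)
    ultimately show ?thesis using d by simp
  qed simp
  have "filling_gf (word (Node v ts # F) @ r) (b # st) x
      = (\<Sum>z\<in>{x - 1..x}. if b \<le> z then q ^ (b * Suc (n + m)) * crossing_sum n (forest_op ts) (down_op h) (z - b) else 0)"
    by (simp add: filling_gf_Up inner)
  also have "\<dots> = (\<Sum>z\<in>{x - b - 1..x - b}. q ^ (b * Suc (n + m)) * crossing_sum n (forest_op ts) (down_op h) z)"
  proof -
    have "(\<Sum>z\<in>{x - b - 1..x - b}. q ^ (b * Suc (n + m)) * crossing_sum n (forest_op ts) (down_op h) z)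
      = (\<Sum>z | z \<in> {x - 1..x} \<and> b \<le> z. q ^ (b * Suc (n + m)) * crossing_sum n (forest_op ts) (down_op h) (z - b))"
      by (rule sum.reindex_bij_witness[of _ "\<lambda>z. z - b" "\<lambda>z. z + b"]) (use Cons.prems in auto)
    then show ?thesis by (simp only: sum.inter_filter finite_atLeastAtMost)
  qed
  also have "\<dots> = q ^ (b * Suc (n + m)) * tree_op n (forest_op ts) h (x - b)"
    by (simp add: tree_op_def sum_distrib_left)
  finally show ?case by (simp only: size forest_op.simps n_def h_def)
qed

lemma filling_gf_word:
  "filling_gf (word F) [0] 0 = forest_op F (\<lambda>x. if x = 0 then 1 else 0) 0"
  using filling_gf_forest[of 0 0 F "[]" "[]"] by (simp add: filling_gf_Nil cong: if_cong)

section \<open>Inversions of words\<close>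

definition inv_positions :: "nat list \<Rightarrow> (nat \<times> nat) set" where
  "inv_positions w = {(i, j). i < j \<and> j < length w \<and> w ! i > w ! j}"

lemma inversions_alt: "inversions w = card (inv_positions w)"
  by (simp add: inversions_def inv_positions_def)

lemma finite_inv_positions [simp]: "finite (inv_positions w)"
  by (rule finite_subset[of _ "{..<length w} \<times> {..<length w}"]) (auto simp: inv_positions_def)

lemma inv_positions_replicate [simp]: "inv_positions (replicate n a) = {}"
  by (auto simp: inv_positions_def)

lemma inv_positions_Nil [simp]: "inv_positions [] = {}"
  by (simp add: inv_positions_def)

definition cross_inversions :: "nat set \<Rightarrow> nat set \<Rightarrow> nat" where
  "cross_inversions B C = card {(b, c). b \<in> B \<and> c \<in> C \<and> c < b}"

lemma inv_positions_append:
  "inv_positions (u @ v) = inv_positions u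
     \<union> (\<lambda>(i, j). (i + length u, j + length u)) ` inv_positions v
     \<union> (\<lambda>(i, j). (i, j + length u)) ` {(i, j). i < length u \<and> j < length v \<and> v ! j < u ! i}"
  (is "?L = ?A \<union> ?B \<union> ?C")
proof
  show "?L \<subseteq> ?A \<union> ?B \<union> ?C"
  proof clarify
    fix i j assume ij: "(i, j) \<in> ?L" "(i, j) \<notin> ?C" "(i, j) \<notin> ?B"
    then have h: "i < j" "j < length u + length v" "(u @ v) ! j < (u @ v) ! i"
      by (auto simp: inv_positions_def)
    show "(i, j) \<in> ?A"
    proof (cases "j < length u")
      case True then show ?thesis using h by (auto simp: inv_positions_def nth_append)
    next
      case False
      then have j: "j = j - length u + length u" by simp
      show ?thesis
      proof (cases "i < length u")
        case True
        have "(i, j - length u) \<in> {(i, j). i < length u \<and> j < length v \<and> v ! j < u ! i}"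
          using h True False by (auto simp: nth_append)
        then have "(i, j) \<in> ?C" using j by (auto intro!: image_eqI[of _ _ "(i, j - length u)"])
        then show ?thesis using ij by blast
      next
        case i: False
        have "(i - length u, j - length u) \<in> inv_positions v"
          using h i False by (auto simp: nth_append inv_positions_def)
        then have "(i, j) \<in> ?B" using j i by (auto intro!: image_eqI[of _ _ "(i - length u, j - length u)"])
        then show ?thesis using ij by blast
      qed
    qed
  qed
  show "?A \<union> ?B \<union> ?C \<subseteq> ?L" by (auto simp: inv_positions_def nth_append)
qed

lemma inversions_append:
  assumes "distinct u" "distinct v"
  shows "inversions (u @ v) = inversions u + inversions v + cross_inversions (set u) (set v)"
proof -
  define B where "B = (\<lambda>(i, j). (i + length u, j + length u)) ` inv_positions v"
  define C' where "C' = {(i, j). i < length u \<and> j < length v \<and> v ! j < u ! i}"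
  define C where "C = (\<lambda>(i, j). (i, j + length u)) ` C'"
  have fin: "finite C'"
    by (rule finite_subset[of _ "{..<length u} \<times> {..<length v}"]) (auto simp: C'_def)
  have cB: "card B = inversions v"
    unfolding B_def inversions_alt by (rule card_image) (auto simp: inj_on_def)
  have "card C = card C'"
    unfolding C_def by (rule card_image) (auto simp: inj_on_def)
  also have "\<dots> = card ((\<lambda>(i, j). (u ! i, v ! j)) ` C')"
    using assms by (intro card_image[symmetric]) (auto simp: inj_on_def C'_def nth_eq_iff_index_eq)
  also have "(\<lambda>(i, j). (u ! i, v ! j)) ` C' = {(b, c). b \<in> set u \<and> c \<in> set v \<and> c < b}"
    by (auto simp: C'_def in_set_conv_nth image_iff)
  finally have cC: "card C = cross_inversions (set u) (set v)" by (simp add: cross_inversions_def)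
  have d: "inv_positions u \<inter> B = {}" "(inv_positions u \<union> B) \<inter> C = {}"
    by (auto simp: B_def C_def C'_def inv_positions_def)
  have "inv_positions (u @ v) = inv_positions u \<union> B \<union> C"
    unfolding B_def C_def C'_def by (rule inv_positions_append)
  then have "card (inv_positions (u @ v)) = card (inv_positions u) + card B + card C"
    using d fin by (simp add: card_Un_disjoint B_def C_def)
  then show ?thesis by (simp add: cB cC inversions_alt)
qed

text \<open>If all letters of \<open>u\<close> are at most those of \<open>v\<close>, then \<open>u @ v\<close> has no inversion between the two parts,
  so all prescribed inversions lie within the parts.\<close>

lemma inv_positions_append_mono:
  assumes "length u = length u'" "length v = length v'" "\<And>a b. a \<in> set u \<Longrightarrow> b \<in> set v \<Longrightarrow> a \<le> b"
  shows "inv_positions (u @ v) \<subseteq> inv_positions (u' @ v')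
     \<longleftrightarrow> inv_positions u \<subseteq> inv_positions u' \<and> inv_positions v \<subseteq> inv_positions v'"
proof -
  have "{(i, j). i < length u \<and> j < length v \<and> v ! j < u ! i} = {}"
  proof -
    have "\<not> v ! j < u ! i" if "i < length u" "j < length v" for i j
      using assms(3)[of "u ! i" "v ! j"] that by (simp add: not_less)
    then show ?thesis by blast
  qed
  then have e: "inv_positions (u @ v) = inv_positions u \<union> (\<lambda>(i, j). (i + length u, j + length u)) ` inv_positions v"
    unfolding inv_positions_append by (simp only: image_empty Un_empty_right)
  show ?thesis
  proof
    assume L: "inv_positions (u @ v) \<subseteq> inv_positions (u' @ v')"
    have "(i, j) \<in> inv_positions u'" if "(i, j) \<in> inv_positions u" for i j
    proof -
      have "(i, j) \<in> inv_positions (u' @ v')" using L e that by blast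
      then show ?thesis using that assms(1) by (auto simp: inv_positions_def nth_append)
    qed
    moreover have "(i, j) \<in> inv_positions v'" if "(i, j) \<in> inv_positions v" for i j
    proof -
      have "(i + length u, j + length u) \<in> inv_positions (u' @ v')" using L e that by blast
      then show ?thesis using assms(1) by (auto simp: inv_positions_def nth_append)
    qed
    ultimately show "inv_positions u \<subseteq> inv_positions u' \<and> inv_positions v \<subseteq> inv_positions v'" by auto
  next
    assume "inv_positions u \<subseteq> inv_positions u' \<and> inv_positions v \<subseteq> inv_positions v'"
    then show "inv_positions (u @ v) \<subseteq> inv_positions (u' @ v')"
      unfolding e using inv_positions_append[of u' v'] assms(1) by auto
  qed
qed

lemma inv_positions_snoc:
  assumes "\<And>b. b \<in> set u \<Longrightarrow> a < b"
  shows "inv_positions (u @ [a]) = inv_positions u \<union> {..<length u} \<times> {length u}"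
proof -
  have "a < u ! i" if "i < length u" for i using assms that by simp
  then show ?thesis by (auto simp: inv_positions_def nth_append less_Suc_eq)
qed

lemma inversions_snoc:
  assumes "\<And>b. b \<in> set u \<Longrightarrow> a < b"
  shows "inversions (u @ [a]) = inversions u + length u"
proof -
  have "inv_positions u \<inter> {..<length u} \<times> {length u} = {}"
    by (auto simp: inv_positions_def)
  then have "card (inv_positions u \<union> {..<length u} \<times> {length u})
      = card (inv_positions u) + card ({..<length u} \<times> {length u})"
    by (intro card_Un_disjoint) simp_all
  then show ?thesis by (simp add: inversions_alt inv_positions_snoc[OF assms])
qed

text \<open>By \<open>left_weak_le_iff\<close> below, for a permutation \<open>v\<close> of \<open>{1..n}\<close> and \<open>A = {1..n}\<close> the sum runs over the
  permutations above \<open>v\<close> in the left weak order.  Other sets of letters, and words \<open>v\<close> with other letters, are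
  needed for the recursion.\<close>

definition above_gf :: "nat list \<Rightarrow> nat set \<Rightarrow> int poly" where
  "above_gf v A = (\<Sum>w | w \<in> permutations_of_set A \<and> inv_positions v \<subseteq> inv_positions w. q ^ inversions w)"

text \<open>The first part of \<open>w\<close> may use any set \<open>B\<close> of letters of the right size; the two parts are then chosen
  independently, and the inversions between them depend only on \<open>B\<close>.\<close>

lemma above_gf_append:
  assumes A: "finite A" "card A = length u + length v" and le: "\<And>a b. a \<in> set u \<Longrightarrow> b \<in> set v \<Longrightarrow> a \<le> b"
  shows "above_gf (u @ v) A = (\<Sum>B | B \<subseteq> A \<and> card B = length u.
           q ^ cross_inversions B (A - B) * (above_gf u B * above_gf v (A - B)))"
proof -
  define Q where "Q v B = {w. w \<in> permutations_of_set B \<and> inv_positions v \<subseteq> inv_positions w}" for v B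
  have fin: "finite (Q v B)" for v B
    unfolding Q_def by (rule finite_subset[OF _ finite_permutations_of_set[of B]]) auto
  have finB: "finite {B. B \<subseteq> A \<and> card B = length u}" using A(1) by simp
  have "(\<Sum>B | B \<subseteq> A \<and> card B = length u.
           q ^ cross_inversions B (A - B) * (above_gf u B * above_gf v (A - B)))
     = (\<Sum>(B, w1, w2) \<in> Sigma {B. B \<subseteq> A \<and> card B = length u} (\<lambda>B. Q u B \<times> Q v (A - B)).
          q ^ cross_inversions B (A - B) * (q ^ inversions w1 * q ^ inversions w2))"
  proof -
    have "q ^ cross_inversions B (A - B) * (above_gf u B * above_gf v (A - B))
       = (\<Sum>(w1, w2)\<in>Q u B \<times> Q v (A - B). q ^ cross_inversions B (A - B) * (q ^ inversions w1 * q ^ inversions w2))" for B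
      by (simp add: above_gf_def Q_def[symmetric] sum_product sum.cartesian_product)
        (simp add: sum_distrib_left split_beta)
    then show ?thesis using fin finB by (simp add: sum.Sigma)
  qed
  also have "\<dots> = (\<Sum>w\<in>Q (u @ v) A. q ^ inversions w)"
  proof (rule sum.reindex_bij_witness[of _ "\<lambda>w. (set (take (length u) w), take (length u) w, drop (length u) w)"
        "\<lambda>(B, w1, w2). w1 @ w2"])
    fix x assume "x \<in> Sigma {B. B \<subseteq> A \<and> card B = length u} (\<lambda>B. Q u B \<times> Q v (A - B))"
    then obtain B w1 w2 where x: "x = (B, w1, w2)" and B: "B \<subseteq> A" "card B = length u"
      and w: "w1 \<in> Q u B" "w2 \<in> Q v (A - B)" by auto
    have s: "set w1 = B" "distinct w1" "set w2 = A - B" "distinct w2"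
      using w by (auto simp: Q_def permutations_of_set_def)
    have l1: "length w1 = length u" using s B distinct_card[of w1] by simp
    have l2: "length w2 = length v"
      using s B A distinct_card[of w2] card_Diff_subset[of B A] finite_subset[of B A] by simp
    show "(case x of (B, w1, w2) \<Rightarrow> w1 @ w2) \<in> Q (u @ v) A"
      using s B w le inv_positions_append_mono[of u w1 v w2] l1 l2
      by (auto simp: x Q_def permutations_of_set_def)
    show "(\<lambda>w. (set (take (length u) w), take (length u) w, drop (length u) w))
        (case x of (B, w1, w2) \<Rightarrow> w1 @ w2) = x"
      using s l1 by (simp add: x)
    show "q ^ inversions (case x of (B, w1, w2) \<Rightarrow> w1 @ w2)
      = (case x of (B, w1, w2) \<Rightarrow> q ^ cross_inversions B (A - B) * (q ^ inversions w1 * q ^ inversions w2))"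
      using s by (simp add: x inversions_append power_add mult.commute)
  next
    fix w assume "w \<in> Q (u @ v) A"
    then have w: "set w = A" "distinct w" "inv_positions (u @ v) \<subseteq> inv_positions w"
      by (auto simp: Q_def permutations_of_set_def)
    have lw: "length w = length u + length v" using w A distinct_card[of w] by simp
    define w1 w2 where "w1 = take (length u) w" and "w2 = drop (length u) w"
    have e: "w = w1 @ w2" by (simp add: w1_def w2_def)
    have l: "length w1 = length u" "length w2 = length v" using lw by (auto simp: w1_def w2_def)
    have s: "distinct w1" "distinct w2" "set w1 \<inter> set w2 = {}" "set w1 \<union> set w2 = A" using w e by auto
    have "A - set w1 = set w2" using s by auto
    moreover have "inv_positions u \<subseteq> inv_positions w1" "inv_positions v \<subseteq> inv_positions w2"
      using w(3) inv_positions_append_mono[of u w1 v w2] l le unfolding e by auto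
    ultimately have "(set w1, w1, w2) \<in> Sigma {B. B \<subseteq> A \<and> card B = length u} (\<lambda>B. Q u B \<times> Q v (A - B))"
      using s l distinct_card[of w1] by (auto simp: Q_def permutations_of_set_def)
    then show "(set (take (length u) w), take (length u) w, drop (length u) w)
       \<in> Sigma {B. B \<subseteq> A \<and> card B = length u} (\<lambda>B. Q u B \<times> Q v (A - B))"
      by (simp add: w1_def w2_def)
    show "(case (set (take (length u) w), take (length u) w, drop (length u) w) of (B, w1, w2) \<Rightarrow> w1 @ w2) = w"
      by simp
  qed
  finally show ?thesis by (simp add: above_gf_def Q_def)
qed

text \<open>The last letter of \<open>w\<close> must be inverted with all the others, so it is the least one.\<close>

lemma above_gf_snoc:
  assumes A: "finite A" "card A = Suc (length u)" and less: "\<And>b. b \<in> set u \<Longrightarrow> a < b"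
  shows "above_gf (u @ [a]) A = q ^ length u * above_gf u (A - {Min A})"
proof -
  have ne: "A \<noteq> {}" using A by auto
  note inv1 = inv_positions_snoc[OF less]
  have inv2: "inv_positions (w @ [Min A]) = inv_positions w \<union> {..<length u} \<times> {length u}"
      and inv3: "inversions (w @ [Min A]) = inversions w + length u"
    if w: "w \<in> permutations_of_set (A - {Min A})" for w
  proof -
    have s: "set w = A - {Min A}" "distinct w" using w by (auto simp: permutations_of_set_def)
    have l: "length w = length u" using s A ne distinct_card[of w] by simp
    have lt: "Min A < b" if "b \<in> set w" for b
      using that s A(1) by (metis DiffD1 DiffD2 Min.coboundedI insertI1 order_neq_le_trans)
    show "inv_positions (w @ [Min A]) = inv_positions w \<union> {..<length u} \<times> {length u}"
      "inversions (w @ [Min A]) = inversions w + length u"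
      using inv_positions_snoc[OF lt] inversions_snoc[OF lt] l by simp_all
  qed
  have "above_gf (u @ [a]) A = (\<Sum>w | w \<in> permutations_of_set (A - {Min A}) \<and> inv_positions u \<subseteq> inv_positions w.
      q ^ length u * q ^ inversions w)"
    unfolding above_gf_def
  proof (rule sum.reindex_bij_witness[of _ "\<lambda>w. w @ [Min A]" butlast])
    fix w assume "w \<in> {w. w \<in> permutations_of_set A \<and> inv_positions (u @ [a]) \<subseteq> inv_positions w}"
    then have w: "set w = A" "distinct w" "inv_positions (u @ [a]) \<subseteq> inv_positions w"
      by (auto simp: permutations_of_set_def)
    have lw: "length w = Suc (length u)" using w A distinct_card[of w] by simp
    then have e: "w = butlast w @ [last w]" by (metis append_butlast_last_id length_0_conv nat.distinct(1))
    have l: "length (butlast w) = length u" using lw by simp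
    have last: "last w = w ! length u" using lw by (metis diff_Suc_1 last_conv_nth length_0_conv nat.distinct(1))
    have small: "last w \<le> b" if b: "b \<in> A" for b
    proof -
      obtain i where i: "i < length w" "b = w ! i" using b w(1) by (metis in_set_conv_nth)
      show ?thesis
      proof (cases "i = length u")
        case False
        then have "(i, length u) \<in> inv_positions (u @ [a])" using i lw inv1 by auto
        then show ?thesis using w(3) i last by (auto simp: inv_positions_def)
      qed (use i last in simp)
    qed
    have "last w \<in> A" using w(1) lw by (metis last_in_set length_0_conv nat.distinct(1))
    then have min: "last w = Min A" using small A(1) by (metis Min_eqI)
    define u' where "u' = butlast w"
    have "w = u' @ [Min A]" using e min by (simp add: u'_def)
    then have b: "set u' = A - {Min A}" "distinct u'" using w(1,2) by auto
    then have bp: "butlast w \<in> permutations_of_set (A - {Min A})" by (simp add: permutations_of_set_def u'_def)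
    show *: "butlast w @ [Min A] = w" using e min by simp
    have "inv_positions u \<subseteq> inv_positions (butlast w)"
    proof
      fix x assume x: "x \<in> inv_positions u"
      then have "x \<in> inv_positions (butlast w) \<union> {..<length u} \<times> {length u}"
        using w(3) inv1 inv2[OF bp] * by auto
      then show "x \<in> inv_positions (butlast w)" using x by (auto simp: inv_positions_def)
    qed
    then show "butlast w \<in> {w. w \<in> permutations_of_set (A - {Min A}) \<and> inv_positions u \<subseteq> inv_positions w}"
      using bp by simp
    show "q ^ length u * q ^ inversions (butlast w) = q ^ inversions w"
      using inv3[OF bp] * by (simp add: power_add mult.commute)
  next
    fix w assume w: "w \<in> {w. w \<in> permutations_of_set (A - {Min A}) \<and> inv_positions u \<subseteq> inv_positions w}"
    then show "w @ [Min A] \<in> {w. w \<in> permutations_of_set A \<and> inv_positions (u @ [a]) \<subseteq> inv_positions w}"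
      using inv1 inv2[of w] A(1) Min_in[OF A(1) ne] by (auto simp: permutations_of_set_def)
  qed simp
  then show ?thesis by (simp add: above_gf_def sum_distrib_left)
qed

lemma sum_rank:
  fixes A :: "nat set"
  assumes "finite A" shows "(\<Sum>b\<in>A. q ^ card {c \<in> A. c < b}) = qnum (card A)"
  using assms
proof (induction rule: finite_linorder_max_induct)
  case (insert b A)
  have "{c \<in> insert b A. c < b} = A" using insert by auto
  moreover have "{c \<in> insert b A. c < x} = {c \<in> A. c < x}" if "x \<in> A" for x
    using insert that by auto
  moreover have "b \<notin> A" using insert by blast
  ultimately have "(\<Sum>x\<in>insert b A. q ^ card {c \<in> insert b A. c < x})
      = q ^ card A + (\<Sum>x\<in>A. q ^ card {c \<in> A. c < x})"
    using insert(1) by simp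
  moreover have "qnum (card (insert b A)) = qnum (card A) + q ^ card A"
    using insert(1) \<open>b \<notin> A\<close> by (simp add: qnum_Suc')
  ultimately show ?case by (simp only: insert.IH add.commute)
qed simp

text \<open>A constant word has no inversions, so the sum runs over all permutations of \<open>A\<close>.\<close>

lemma above_gf_replicate_0: 
  "finite A \<Longrightarrow> card A = n \<Longrightarrow> above_gf (replicate n 0) A = qfact n"
proof (induction n arbitrary: A)
  case 0
  then show ?case by (simp add: above_gf_def qfact_def inversions_alt)
next
  case (Suc n)
  have "above_gf (replicate (Suc n) 0) A = above_gf ([0] @ replicate n 0) A" by simp
  also have "\<dots> = (\<Sum>B | B \<subseteq> A \<and> card B = 1.
           q ^ cross_inversions B (A - B) * (above_gf [0] B * above_gf (replicate n 0) (A - B)))"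
    using above_gf_append[of A "[0]" "replicate n 0"] Suc.prems by simp
  also have "\<dots> = (\<Sum>b\<in>A. q ^ card {c \<in> A. c < b} * qfact n)"
  proof (rule sum.reindex_bij_witness[of _ "\<lambda>b. {b}" the_elem])
    fix B assume "B \<in> {B. B \<subseteq> A \<and> card B = 1}"
    then obtain b where b: "B = {b}" "b \<in> A" by (auto simp: card_1_singleton_iff)
    then show "{the_elem B} = B" "the_elem B \<in> A" by auto
    have "cross_inversions {b} (A - {b}) = card (Pair b ` {c \<in> A. c < b})"
      unfolding cross_inversions_def by (rule arg_cong[of _ _ card]) auto
    also have "\<dots> = card {c \<in> A. c < b}" by (simp add: card_image inj_on_def)
    finally have x: "cross_inversions {b} (A - {b}) = card {c \<in> A. c < b}" .
    have "inv_positions [x] = {}" for x by (auto simp: inv_positions_def)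
    then have "above_gf [0] {b} = 1" by (simp add: above_gf_def inversions_alt cong: conj_cong)
    moreover have "above_gf (replicate n 0) (A - {b}) = qfact n"
      using Suc b by simp
    ultimately show "q ^ card {c \<in> A. c < the_elem B} * qfact n
       = q ^ cross_inversions B (A - B) * (above_gf [0] B * above_gf (replicate n 0) (A - B))"
      using x b by simp
  qed auto
  also have "\<dots> = (\<Sum>b\<in>A. q ^ card {c \<in> A. c < b}) * qfact n" by (simp only: sum_distrib_right)
  also have "\<dots> = qfact (Suc n)"
    using sum_rank[OF Suc.prems(1)] Suc.prems by (simp add: qfact_def)
  finally show ?case .
qed

text \<open>The case of \<open>above_gf_append\<close> in which no inversions are prescribed: a product formula for
  the q-binomial coefficient, without division.\<close>

lemma sum_cross_inversions:
  assumes "finite A" "card A = m + n"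
  shows "(\<Sum>B | B \<subseteq> A \<and> card B = m. q ^ cross_inversions B (A - B) * (qfact m * qfact n)) = qfact (m + n)"
proof -
  have "above_gf (replicate m 0 @ replicate n 0) A = qfact (m + n)"
    using above_gf_replicate_0 assms by (simp flip: replicate_add)
  moreover have "above_gf (replicate m 0) B = qfact m" "above_gf (replicate n 0) (A - B) = qfact n"
    if "B \<subseteq> A" "card B = m" for B
    using that assms finite_subset[of B A] card_Diff_subset[of B A]
    by (auto intro!: above_gf_replicate_0)
  ultimately show ?thesis using above_gf_append[of A "replicate m 0" "replicate n 0"] assms by simp
qed

section \<open>The left weak order\<close>

lemma transpose_Suc_less_iff:
  assumes "x \<noteq> y" "{x, y} \<noteq> {i, Suc i}"
  shows "transpose i (Suc i) x < transpose i (Suc i) y \<longleftrightarrow> x < y"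
  using assms by (auto simp: transpose_def)

text \<open>Exchanging the values \<open>i\<close> and \<open>i + 1\<close> does not affect how either compares with a third value.\<close>

lemma inv_positions_transpose:
  assumes v: "distinct v" and a: "a < b" "b < length v" "v ! a = i" "v ! b = Suc i"
  shows "inv_positions (map (transpose i (Suc i)) v) = insert (a, b) (inv_positions v)"
    and "(a, b) \<notin> inv_positions v"
proof -
  have "(c, d) \<in> inv_positions (map (transpose i (Suc i)) v) \<longleftrightarrow> (c, d) \<in> insert (a, b) (inv_positions v)"
    for c d
  proof (cases "c < d \<and> d < length v")
    case True
    show ?thesis
    proof (cases "{v ! d, v ! c} = {i, Suc i}")
      case True': True
      then have "{c, d} = {a, b}" using True a v
        by (auto simp: doubleton_eq_iff) (metis nth_eq_iff_index_eq order.strict_trans)+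
      then have "c = a" "d = b" using True a by (auto simp: doubleton_eq_iff)
      then show ?thesis using a by (auto simp: inv_positions_def)
    next
      case False
      have "v ! d \<noteq> v ! c" using True v by (simp add: nth_eq_iff_index_eq)
      moreover have "(c, d) \<noteq> (a, b)" using False a by auto
      ultimately show ?thesis using True transpose_Suc_less_iff[of "v ! d" "v ! c" i] False
        by (auto simp: inv_positions_def)
    qed
  next
    case False
    then show ?thesis using a by (auto simp: inv_positions_def)
  qed
  then show "inv_positions (map (transpose i (Suc i)) v) = insert (a, b) (inv_positions v)" by auto
  show "(a, b) \<notin> inv_positions v" using a by (simp add: inv_positions_def)
qed

lemma perms_position:
  assumes "v \<in> perms n" "i \<in> {1..n}"
  obtains a where "a < length v" "v ! a = i"
  using assms by (metis in_set_conv_nth permutations_of_setD(1))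

lemma map_transpose_perms:
  assumes "v \<in> perms n" "i \<in> {1..<n}"
  shows "map (transpose i (Suc i)) v \<in> perms n"
proof -
  have "transpose i (Suc i) ` {1..n} = {1..n}"
    using assms(2) by (intro transpose_image_eq) auto
  then show ?thesis using assms(1)
    by (auto simp: permutations_of_set_def distinct_map intro: inj_on_subset[OF inj_transpose])
qed

lemma left_weak_cover_inv_positions:
  assumes "left_weak_cover n v w"
  shows "w \<in> perms n" "inv_positions v \<subseteq> inv_positions w"
proof -
  obtain i where v: "v \<in> perms n" and i: "i \<in> {1..<n}"
    and w: "w = map (transpose i (Suc i)) v" and inv: "inversions w = Suc (inversions v)"
    using assms by (auto simp: left_weak_cover_def)
  show wp: "w \<in> perms n" using map_transpose_perms v i w by simp
  obtain a where a: "a < length v" "v ! a = i" using perms_position[OF v, of i] i by auto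
  obtain b where b: "b < length v" "v ! b = Suc i" using perms_position[OF v, of "Suc i"] i by auto
  have d: "distinct v" "distinct w" using v wp by (auto simp: permutations_of_set_def)
  consider "a < b" | "b < a" using a b by (metis linorder_neqE_nat n_not_Suc_n)
  then show "inv_positions v \<subseteq> inv_positions w"
  proof cases
    case 1
    then show ?thesis using inv_positions_transpose[OF d(1) 1 b(1) a(2) b(2)] w by auto
  next
    \<comment> \<open>Here the exchange would remove an inversion, contrary to the definition of a cover.\<close>
    case 2
    have "w ! b = i" "w ! a = Suc i" using a b w by auto
    from inv_positions_transpose[OF d(2) 2 _ this]
    have "inv_positions (map (transpose i (Suc i)) w) = insert (b, a) (inv_positions w)"
      "(b, a) \<notin> inv_positions w" using a w by auto
    moreover have "map (transpose i (Suc i)) w = v" using w by (simp add: comp_def)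
    ultimately have "inversions v = Suc (inversions w)" by (simp add: inversions_alt)
    then show ?thesis using inv by simp
  qed
qed

text \<open>Otherwise \<open>w\<close> would be increasing along the positions of consecutive values of \<open>v\<close>: where \<open>v\<close> has
  \<open>i + 1\<close> before \<open>i\<close> by hypothesis, and elsewhere by assumption.  An increasing map of \<open>{1..n}\<close> to itself
  is the identity, so \<open>w\<close> would be \<open>v\<close>.\<close>

lemma ex_cover_below:
  assumes v: "v \<in> perms n" and w: "w \<in> perms n" and sub: "inv_positions v \<subseteq> inv_positions w"
    and ne: "v \<noteq> w"
  obtains i a b where "i \<in> {1..<n}" "a < b" "b < length v" "v ! a = i" "v ! b = Suc i" "(a, b) \<in> inv_positions w"
proof (rule ccontr)
  assume H: "\<not> thesis"
  note witness = that
  have len: "length v = n" "length w = n" using v w by (auto simp: length_finite_permutations_of_set)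
  have d: "distinct v" "distinct w" and set: "set v = {1..n}" "set w = {1..n}"
    using v w by (auto simp: permutations_of_set_def)
  have "\<forall>i\<in>{1..n}. \<exists>a. a < n \<and> v ! a = i" using perms_position[OF v] len by metis
  then obtain pos where pos: "\<And>i. i \<in> {1..n} \<Longrightarrow> pos i < n \<and> v ! pos i = i" by metis
  have rises: "w ! pos i < w ! pos (Suc i)" if "1 \<le> i" "i < n" for i
  proof -
    have p: "pos i < n" "v ! pos i = i" "pos (Suc i) < n" "v ! pos (Suc i) = Suc i"
      using pos[of i] pos[of "Suc i"] that by auto
    then have neq: "pos i \<noteq> pos (Suc i)" by auto
    show ?thesis
    proof (cases "pos i < pos (Suc i)")
      case True
      have "(pos i, pos (Suc i)) \<notin> inv_positions w"
        using H witness[of i "pos i" "pos (Suc i)"] that p True len by auto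
      then have "\<not> w ! pos i > w ! pos (Suc i)" using True p len by (simp add: inv_positions_def)
      moreover have "w ! pos i \<noteq> w ! pos (Suc i)" using neq p d len by (simp add: nth_eq_iff_index_eq)
      ultimately show ?thesis by simp
    next
      case False
      then have "(pos (Suc i), pos i) \<in> inv_positions v" using neq p len by (simp add: inv_positions_def)
      then show ?thesis using sub by (auto simp: inv_positions_def)
    qed
  qed
  \<comment> \<open>The letters of \<open>w\<close>, read in the order of the positions of \<open>1, \<dots>, n\<close> in \<open>v\<close>, increase and lie in \<open>{1..n}\<close>.\<close>
  have ge: "i \<le> w ! pos i" if "1 \<le> i" "i \<le> n" for i
    using that
  proof (induction i rule: dec_induct)
    case base
    then have "w ! pos 1 \<in> set w" using pos[of 1] len by simp
    then show ?case using set by simp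
  next
    case (step i) then show ?case using rises[of i] by simp
  qed
  have le: "w ! pos i \<le> i" if "1 \<le> i" "i \<le> n" for i
    using that(2,1)
  proof (induction i rule: inc_induct)
    case base
    then have "w ! pos n \<in> set w" using pos[of n] len by simp
    then show ?case using set by simp
  next
    case (step i) then show ?case using rises[of i] by simp
  qed
  have "v ! c = w ! c" if c: "c < n" for c
  proof -
    have i: "v ! c \<in> {1..n}" using c set len nth_mem[of c v] by auto
    then have "pos (v ! c) = c" using pos[of "v ! c"] d c len by (metis nth_eq_iff_index_eq)
    then show ?thesis using ge[of "v ! c"] le[of "v ! c"] i by simp
  qed
  then show False using ne len by (simp add: list_eq_iff_nth_eq)
qed

text \<open>A cover adds one position pair.  Conversely, as long as \<open>v \<noteq> w\<close> there is a cover of \<open>v\<close> whose new inversion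
  already belongs to \<open>w\<close>.\<close>

lemma left_weak_le_iff:
  assumes "v \<in> perms n"
  shows "left_weak_le n v w \<longleftrightarrow> w \<in> perms n \<and> inv_positions v \<subseteq> inv_positions w"
proof
  assume "left_weak_le n v w"
  then show "w \<in> perms n \<and> inv_positions v \<subseteq> inv_positions w"
    unfolding left_weak_le_def
    by (induction rule: rtranclp_induct) (use assms left_weak_cover_inv_positions in blast)+
next
  assume "w \<in> perms n \<and> inv_positions v \<subseteq> inv_positions w"
  then show "left_weak_le n v w" using assms
  proof (induction "card (inv_positions w - inv_positions v)" arbitrary: v rule: less_induct)
    case (less v)
    show ?case
    proof (cases "v = w")
      case False
      then obtain i a b where i: "i \<in> {1..<n}"
        and ab: "a < b" "b < length v" "v ! a = i" "v ! b = Suc i" "(a, b) \<in> inv_positions w"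
        using ex_cover_below[of v n w] less.prems by blast
      define v' where "v' = map (transpose i (Suc i)) v"
      have "distinct v" using less.prems by (auto simp: permutations_of_set_def)
      from inv_positions_transpose[OF this ab(1-4)]
      have e: "inv_positions v' = insert (a, b) (inv_positions v)" "(a, b) \<notin> inv_positions v"
        by (simp_all add: v'_def)
      have p: "v' \<in> perms n" unfolding v'_def using map_transpose_perms less.prems i by blast
      have "inversions v' = inversions v + 1" by (simp add: inversions_alt e)
      then have c: "left_weak_cover n v v'"
        using less.prems i by (auto simp: left_weak_cover_def v'_def)
      have "inv_positions w - inv_positions v' \<subset> inv_positions w - inv_positions v" using e ab by auto
      then have "card (inv_positions w - inv_positions v') < card (inv_positions w - inv_positions v)"
        by (rule psubset_card_mono[rotated]) simp
      then have "left_weak_le n v' w" using less p e ab by auto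
      then show ?thesis using c unfolding left_weak_le_def by (rule converse_rtranclp_into_rtranclp[rotated])
    qed (simp add: left_weak_le_def)
  qed
qed

section \<open>Increasing labelings\<close>

lemma tree_op_scale:
  assumes "\<And>f y. c * Q f y = d * R f y"
  shows "c * tree_op n Q f x = d * tree_op n R f x"
  using assms by (simp add: tree_op_def crossing_sum_def sum_distrib_left mult.left_commute[of c] mult.left_commute[of d])

lemma forest_preorder_simps [simp]:
  "forest_preorder [] = []"
  "forest_preorder (Node v ts # F) = v # forest_preorder ts @ forest_preorder F"
  by (simp_all add: forest_preorder_def)

lemma forest_postorder_simps [simp]:
  "forest_postorder [] = []"
  "forest_postorder (Node v ts # F) = forest_postorder ts @ v # forest_postorder F"
  by (simp_all add: forest_postorder_def)

lemma mset_forest_postorder: "mset (forest_postorder F) = mset (forest_preorder F)"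
  by (induction F rule: word.induct[case_names Nil Cons]) auto

text \<open>The comparison of the two recursions.  The function \<open>f\<close> is arbitrary so that the operators of the
  trees can be composed, and the set \<open>A\<close> of letters is arbitrary because the first tree receives an arbitrary
  part of the letters.  In the word \<open>post F L\<close> the labels of the first tree are below those of the others and its
  root is below its descendants, so that \<open>above_gf_append\<close> and \<open>above_gf_snoc\<close> apply.\<close>

lemma forest_op_above_gf:
  assumes "sorted_wrt (<) (pre F L)" "finite A" "card A = num_vertices F"
  shows "qfact (num_vertices F) * (q ^ inversions (post F L) * forest_op F f x)
     = above_gf (post F L) A * (peak_op ^^ num_vertices F) f x"
  using assms
proof (induction F arbitrary: A f x rule: word.induct[case_names Nil Cons])
  case Nil
  then show ?case
    using above_gf_replicate_0[of A 0] by (simp add: post_def inversions_alt qfact_def)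
next
  case (Cons v ts F)
  define n m where "n = num_vertices ts" and "m = num_vertices F"
  define u w where "u = post ts L" and "w = post F L"
  have len: "length u = n" "length w = m"
    using mset_forest_postorder[THEN mset_eq_length, of ts] mset_forest_postorder[THEN mset_eq_length, of F]
    by (simp_all add: u_def w_def n_def m_def post_def)
  have set: "set u = L ` set (forest_preorder ts)" "set w = L ` set (forest_preorder F)"
    using mset_forest_postorder[THEN mset_eq_setD, of ts] mset_forest_postorder[THEN mset_eq_setD, of F]
    by (simp_all add: u_def w_def post_def)
  have sorted: "sorted_wrt (<) (pre ts L)" "sorted_wrt (<) (pre F L)"
    using Cons.prems(1) by (auto simp: pre_def sorted_wrt_append)
  have v_less: "L v < b" if "b \<in> set u" for b
    using Cons.prems(1) that set by (auto simp: pre_def)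
  have less: "a < b" if "a \<in> set (u @ [L v])" "b \<in> set w" for a b
    using Cons.prems(1) that set by (auto simp: pre_def sorted_wrt_append)
  have "distinct (pre ts L)" "distinct (pre F L)"
    using sorted strict_sorted_iff by blast+
  moreover have "mset u = mset (pre ts L)" "mset w = mset (pre F L)"
    by (simp_all add: u_def w_def post_def pre_def mset_forest_postorder)
  ultimately have "distinct u" "distinct w" by (metis mset_eq_imp_distinct_iff)+
  then have dist: "distinct (u @ [L v])" "distinct w" using v_less by auto
  have post: "post (Node v ts # F) L = (u @ [L v]) @ w"
    by (simp add: post_def u_def w_def)
  have size: "num_vertices (Node v ts # F) = Suc n + m"
    by (simp add: n_def m_def)
  have "cross_inversions (set (u @ [L v])) (set w) = 0"
    unfolding cross_inversions_def using less by (auto simp: card_eq_0_iff dest: order.asym)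
  then have inv: "inversions ((u @ [L v]) @ w) = inversions (u @ [L v]) + inversions w"
    using inversions_append[OF dist] by simp
  \<comment> \<open>The first tree: its root adds \<open>n\<close> inversions and the factor \<open>qnum (Suc n)\<close> of \<open>tree_op_peaks\<close>.\<close>
  have tree: "qfact (Suc n) * (q ^ inversions (u @ [L v]) * tree_op n (forest_op ts) g x)
      = above_gf (u @ [L v]) B * (peak_op ^^ Suc n) g x"
    if B: "finite B" "card B = Suc n" for B g x
  proof -
    have "card (B - {Min B}) = n" using B by (subst card_Diff_singleton) (auto intro!: Min_in)
    then have "(qfact n * q ^ inversions u) * forest_op ts h y
        = above_gf u (B - {Min B}) * (peak_op ^^ n) h y" for h y
      using Cons.IH(1)[OF sorted(1), of "B - {Min B}" h y] B by (simp add: n_def u_def mult.assoc)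
    then have "(qfact n * q ^ inversions u) * tree_op n (forest_op ts) g x
        = above_gf u (B - {Min B}) * tree_op n (peak_op ^^ n) g x"
      by (rule tree_op_scale)
    then have "qnum (Suc n) * q ^ n * ((qfact n * q ^ inversions u) * tree_op n (forest_op ts) g x)
        = q ^ n * above_gf u (B - {Min B}) * (qnum (Suc n) * tree_op n (peak_op ^^ n) g x)"
      by (simp only: mult.assoc mult.left_commute[of "qnum _"])
    moreover have "inversions (u @ [L v]) = inversions u + n" using inversions_snoc[OF v_less] len by simp
    moreover have "above_gf (u @ [L v]) B = q ^ n * above_gf u (B - {Min B})"
      using above_gf_snoc[of B u "L v"] B v_less len by simp
    moreover have "qfact (Suc n) = qnum (Suc n) * qfact n" by (simp add: qfact_def)
    ultimately show ?thesis by (simp add: tree_op_peaks power_add ac_simps del: funpow.simps)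
  qed
  \<comment> \<open>The first tree and the rest of the forest, for a fixed distribution of the letters.\<close>
  have both: "(qfact (Suc n) * qfact m) * (q ^ inversions ((u @ [L v]) @ w) * forest_op (Node v ts # F) f x)
      = above_gf (u @ [L v]) B * above_gf w (A - B) * (peak_op ^^ (Suc n + m)) f x"
    if B: "B \<subseteq> A" "card B = Suc n" for B
  proof -
    have fin: "finite B" using B Cons.prems(2) finite_subset by blast
    have "card (A - B) = m" using B fin Cons.prems(3) size by (simp add: card_Diff_subset)
    then have F: "(qfact m * q ^ inversions w) * forest_op F f y = above_gf w (A - B) * (peak_op ^^ m) f y" for y
      using Cons.IH(2)[OF sorted(2), of "A - B" f y] Cons.prems(2) by (simp add: m_def w_def mult.assoc)
    have "(qfact (Suc n) * qfact m) * (q ^ inversions ((u @ [L v]) @ w) * forest_op (Node v ts # F) f x)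
      = (qfact m * q ^ inversions w) * (qfact (Suc n) * (q ^ inversions (u @ [L v]) * tree_op n (forest_op ts) (forest_op F f) x))"
      unfolding inv by (simp add: n_def power_add ac_simps)
    also have "\<dots> = above_gf (u @ [L v]) B * ((qfact m * q ^ inversions w) * (peak_op ^^ Suc n) (forest_op F f) x)"
      unfolding tree[OF fin B(2)] by (simp only: mult.left_commute)
    also have "(qfact m * q ^ inversions w) * (peak_op ^^ Suc n) (forest_op F f) x
        = (peak_op ^^ Suc n) (\<lambda>y. above_gf w (A - B) * (peak_op ^^ m) f y) x"
      unfolding F[symmetric] peaks_linear(1) ..
    also have "\<dots> = above_gf w (A - B) * (peak_op ^^ (Suc n + m)) f x"
      unfolding peaks_linear(1) funpow_add by simp
    finally show ?thesis by (simp only: mult.assoc)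
  qed
  have cA: "card A = Suc n + m" using Cons.prems(3) size by simp
  have "qfact (Suc n + m) * (q ^ inversions ((u @ [L v]) @ w) * forest_op (Node v ts # F) f x)
     = (\<Sum>B | B \<subseteq> A \<and> card B = Suc n. q ^ cross_inversions B (A - B) *
         ((qfact (Suc n) * qfact m) * (q ^ inversions ((u @ [L v]) @ w) * forest_op (Node v ts # F) f x)))"
    unfolding sum_cross_inversions[OF Cons.prems(2) cA, symmetric] sum_distrib_right mult.assoc ..
  also have "\<dots> = (\<Sum>B | B \<subseteq> A \<and> card B = Suc n. q ^ cross_inversions B (A - B) *
         (above_gf (u @ [L v]) B * above_gf w (A - B)) * (peak_op ^^ (Suc n + m)) f x)"
    using both by (intro sum.cong) (auto simp: mult.assoc)
  also have "\<dots> = above_gf ((u @ [L v]) @ w) A * (peak_op ^^ (Suc n + m)) f x"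
    using above_gf_append[of A "u @ [L v]" w] Cons.prems(2) cA len less
    by (simp add: sum_distrib_right less_imp_le)
  finally show ?case unfolding post size .
qed

section \<open>Fillings in terms of matched steps\<close>

lemma upt_split: "i < j \<Longrightarrow> j < k \<Longrightarrow> [i..<k] = i # [Suc i..<j] @ j # [Suc j..<k]"
  using upt_add_eq_append[of "Suc i" j "k - j"] by (simp add: upt_conv_Cons)

lemma word_forest_between:
  "dyck_segment p i k \<Longrightarrow> word (forest_between p i k) = map ((!) p) [i..<k]"
proof (induction p i k rule: forest_between.induct)
  case (1 p i k)
  show ?case
  proof (cases "i < k")
    case True
    define j where "j = partner p i"
    note s = dyck_segment_partner[OF 1(3) True, folded j_def]
    have ij: "i < j" "p ! i = Up" "p ! j = Down" using s(1) by (simp_all add: matched_iff)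
    have u: "[i..<k] = i # [Suc i..<j] @ j # [Suc j..<k]"
      using upt_split ij(1) s(2) by blast
    show ?thesis
      using 1(1,2) True ij s by (simp add: forest_between_unfold[OF 1(3)] u flip: j_def)
  qed (use 1 in \<open>simp add: forest_between_unfold\<close>)
qed

lemma dyck_path_segment: "dyck_path n p \<Longrightarrow> dyck_segment p 0 (length p)"
  using dyck_segment_iff[of 0 "length p" p] by auto

lemma word_plane_forest: "dyck_path n p \<Longrightarrow> word (plane_forest p) = p"
  by (simp add: plane_forest_def word_forest_between dyck_path_segment map_nth)

lemma matched_between:
  assumes "dyck_segment p i k" "i < k"
  shows "matched p a b \<and> i \<le> a \<and> b < k \<longleftrightarrow> (a, b) = (i, partner p i)
    \<or> matched p a b \<and> Suc i \<le> a \<and> b < partner p i \<or> matched p a b \<and> Suc (partner p i) \<le> a \<and> b < k"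
proof -
  note s = dyck_segment_partner[OF assms]
  have "forest_vertices (forest_between p i k) = insert (i, partner p i)
      (forest_vertices (forest_between p (Suc i) (partner p i))
       \<union> forest_vertices (forest_between p (Suc (partner p i)) k))"
    using assms(2) by (simp add: forest_between_unfold[OF assms(1)] forest_vertices_def forest_preorder_def)
  then show ?thesis
    unfolding forest_between_vertices[OF assms(1)] forest_between_vertices[OF s(3)]
      forest_between_vertices[OF s(4)] by (auto simp: set_eq_iff)
qed

lemma dyck_segment_covered:
  "dyck_segment p i k \<Longrightarrow> i \<le> s \<Longrightarrow> s < k \<Longrightarrow> \<exists>a b. matched p a b \<and> (s = a \<or> s = b)"
proof (induction p i k rule: forest_between.induct)
  case (1 p i k)
  have ik: "i < k" using 1 by simp
  define j where "j = partner p i"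
  note s = dyck_segment_partner[OF 1(3) ik, folded j_def]
  have ij: "i < j" using s(1) by (simp add: matched_iff)
  consider "s = i" | "s = j" | "Suc i \<le> s" "s < j" | "Suc j \<le> s" using 1(4) by linarith
  then show ?case
  proof cases
    case 3 then show ?thesis using 1(1)[folded j_def] ik ij s by blast
  next
    case 4 then show ?thesis using 1(2)[folded j_def] 1(5) ik ij s by blast
  qed (use s(1) in blast)+
qed

text \<open>If the path fell below its initial height inside the segment, then the first down step doing so would have its partner
  outside; likewise, looking backwards, it cannot be below its final height.\<close>

lemma dyck_segment_if_closed:
  assumes p: "dyck_path n p" and l: "l \<le> r" "r \<le> length p"
    and closed: "\<And>i j. matched p i j \<Longrightarrow> l \<le> i \<and> i < r \<longleftrightarrow> l \<le> j \<and> j < r"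
  shows "dyck_segment p l r"
proof -
  have cover: "\<exists>a b. matched p a b \<and> (s = a \<or> s = b)" if "s < length p" for s
    using dyck_segment_covered[OF dyck_path_segment[OF p]] that by simp
  have low: "height p l \<le> height p c" if "l \<le> c" "c \<le> r" for c
    using that
  proof (induction c rule: less_induct)
    case (less c)
    show ?case
    proof (cases "c = l")
      case False
      then obtain s where s: "c = Suc s" "l \<le> s" "s < r" using less.prems by (cases c) auto
      have IH: "height p l \<le> height p s" using less s by simp
      show ?thesis
      proof (cases "p ! s = Up")
        case True then show ?thesis using IH s l height_Suc[of s p] by simp
      next
        case False
        then obtain i where i: "matched p i s" using cover[of s] s l by (auto simp: matched_iff)
        then have "l \<le> i" "i < c" using closed[OF i] s by (auto simp: matched_iff)
        then have "height p l \<le> height p i" using less s by simp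
        then show ?thesis using matched_height(1)[OF i] s by simp
      qed
    qed simp
  qed
  have high: "height p r \<le> height p c" if "l \<le> c" "c \<le> r" for c
    using that
  proof (induction "r - c" arbitrary: c rule: less_induct)
    case less
    show ?case
    proof (cases "c = r")
      case False
      then have c: "c < r" "c < length p" using less.prems l by simp_all
      have IH: "height p r \<le> height p (Suc c)" using less c by simp
      show ?thesis
      proof (cases "p ! c = Down")
        case True then show ?thesis using IH c height_Suc[of c p] by simp
      next
        case False
        then obtain j where j: "matched p c j" using cover[of c] c by (auto simp: matched_iff)
        then have "c < j" "Suc j \<le> r" using closed[OF j] c less.prems by (auto simp: matched_iff)
        then have "height p r \<le> height p (Suc j)" using less by simp
        then show ?thesis using matched_height(1)[OF j] by simp
      qed
    qed simp
  qed
  have "height p r = height p l" using high[of l] low[of r] l by simp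
  then show ?thesis using low l by (simp add: dyck_segment_def)
qed

lemma matched_within_segment:
  assumes "matched p i j" "dyck_segment p l r"
  shows "l \<le> i \<Longrightarrow> i < r \<Longrightarrow> j < r" and "l \<le> j \<Longrightarrow> j < r \<Longrightarrow> l \<le> i"
proof -
  have ij: "i < j" using assms(1) by (simp add: matched_iff)
  have lr: "height p r = height p l" and low: "\<And>c. l \<le> c \<Longrightarrow> c \<le> r \<Longrightarrow> height p l \<le> height p c"
    using assms(2) by (auto simp: dyck_segment_def)
  note m = matched_height[OF assms(1)]
  show "j < r" if "l \<le> i" "i < r"
    using m(2)[of r] low[of i] lr that by force
  show "l \<le> i" if "l \<le> j" "j < r"
    using m(2)[of l] m(1) low[of "Suc j"] that by force
qed

text \<open>The part of the predicate \<open>filling\<close> that concerns the crossing numbers only.\<close>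

fun nested :: "step list \<Rightarrow> nat list \<Rightarrow> nat list \<Rightarrow> bool" where
  "nested [] st [] \<longleftrightarrow> st = [0]"
| "nested (Up # p) (b # st) (a # ks) \<longleftrightarrow> b \<le> a \<and> nested p (a # b # st) ks"
| "nested (Down # p) (b # st) (a # ks) \<longleftrightarrow> a = b \<and> nested p st ks"
| "nested _ _ _ \<longleftrightarrow> False"

definition level_step :: "step \<Rightarrow> nat \<Rightarrow> nat \<Rightarrow> nat \<Rightarrow> bool" where
  "level_step s x a z \<longleftrightarrow> (if s = Up then z \<in> {x - 1..x} else z \<in> {x, Suc x}) \<and> a \<le> min x z"

definition levels :: "nat \<Rightarrow> (nat \<times> nat) list \<Rightarrow> nat \<Rightarrow> nat" where
  "levels x fl c = (case c of 0 \<Rightarrow> x | Suc s \<Rightarrow> snd (fl ! s))"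

lemma filling_iff_nested:
  "filling p st x fl \<longleftrightarrow> length fl = length p \<and> nested p st (map fst fl)
     \<and> (\<forall>s<length p. level_step (p ! s) (levels x fl s) (fst (fl ! s)) (levels x fl (Suc s)))
     \<and> levels x fl (length p) = 0"
proof (induction p st x fl rule: filling.induct)
  case (2 p b st x a z fl)
  have "levels x ((a, z) # fl) (Suc s) = levels z fl s" for s
    by (cases s) (auto simp: levels_def)
  moreover have "levels x ((a, z) # fl) 0 = x" by (simp add: levels_def)
  moreover have "levels z fl 0 = z" by (simp add: levels_def)
  ultimately show ?case using 2 by (auto simp: All_less_Suc2 level_step_def)
next
  case (3 p b st x a z fl)
  have "levels x ((a, z) # fl) (Suc s) = levels z fl s" for s
    by (cases s) (auto simp: levels_def)
  moreover have "levels x ((a, z) # fl) 0 = x" by (simp add: levels_def)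
  moreover have "levels z fl 0 = z" by (simp add: levels_def)
  ultimately show ?case using 3 by (auto simp: All_less_Suc2 level_step_def)
qed (auto simp: levels_def)

text \<open>The list of open steps is replaced by a condition on each matched pair.  The lists \<open>r\<close> and \<open>ks\<close>
  are the rest of the path and of its crossing numbers, which the induction needs.\<close>

lemma nested_forest:
  "dyck_segment p i k \<Longrightarrow>
     nested (word (forest_between p i k) @ r) (b # st) (map f [i..<k] @ ks) \<longleftrightarrow>
       (\<forall>s\<in>{i..<k}. b \<le> f s)
     \<and> (\<forall>a c. matched p a c \<and> i \<le> a \<and> c < k \<longrightarrow> f a = f c \<and> (\<forall>s\<in>{a..c}. f a \<le> f s))
     \<and> nested r (b # st) ks"
proof (induction p i k arbitrary: b st r ks rule: forest_between.induct)
  case (1 p i k)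
  show ?case
  proof (cases "i < k")
    case True
    define j where "j = partner p i"
    note s = dyck_segment_partner[OF 1(3) True, folded j_def]
    have ij: "i < j" using s(1) by (simp add: matched_iff)
    define M where "M i k \<longleftrightarrow> (\<forall>a c. matched p a c \<and> i \<le> a \<and> c < k \<longrightarrow> f a = f c \<and> (\<forall>s\<in>{a..c}. f a \<le> f s))" for i k
    have M: "M i k \<longleftrightarrow> f i = f j \<and> (\<forall>s\<in>{i..j}. f i \<le> f s) \<and> M (Suc i) j \<and> M (Suc j) k"
      unfolding M_def matched_between[OF 1(3) True, folded j_def] by blast
    have u: "[i..<k] = i # [Suc i..<j] @ j # [Suc j..<k]"
      using upt_split ij(1) s(2) by blast
    have f: "forest_between p i k = Node (i, j) (forest_between p (Suc i) j) # forest_between p (Suc j) k"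
      using True by (simp add: forest_between_unfold[OF 1(3)] j_def)
    have "nested (word (forest_between p i k) @ r) (b # st) (map f [i..<k] @ ks) \<longleftrightarrow>
       b \<le> f i \<and> (\<forall>s\<in>{Suc i..<j}. f i \<le> f s) \<and> M (Suc i) j \<and> f j = f i
       \<and> (\<forall>s\<in>{Suc j..<k}. b \<le> f s) \<and> M (Suc j) k \<and> nested r (b # st) ks"
      using 1(1)[folded j_def, of "Down # word (forest_between p (Suc j) k) @ r" "f i" "b # st" "f j # map f [Suc j..<k] @ ks"]
        1(2)[folded j_def, of r b st ks] True ij s unfolding f u M_def by simp
    also have "\<dots> \<longleftrightarrow> (\<forall>s\<in>{i..<k}. b \<le> f s) \<and> M i k \<and> nested r (b # st) ks"
    proof -
      have "{i..<k} = insert i ({Suc i..<j} \<union> insert j {Suc j..<k})" "{i..j} = insert i (insert j {Suc i..<j})"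
        using ij s(2) by auto
      then show ?thesis unfolding M by (auto dest: le_trans)
    qed
    finally show ?thesis by (simp add: M_def)
  next
    case False
    then show ?thesis using 1(3) by (auto simp: forest_between_unfold matched_iff)
  qed
qed

lemma filling_iff:
  assumes "dyck_path n p"
  shows "filling p [0] 0 fl \<longleftrightarrow> length fl = length p
     \<and> (\<forall>s<length p. level_step (p ! s) (levels 0 fl s) (fst (fl ! s)) (levels 0 fl (Suc s)))
     \<and> levels 0 fl (length p) = 0
     \<and> (\<forall>i j. matched p i j \<longrightarrow> fst (fl ! i) = fst (fl ! j) \<and> (\<forall>s\<in>{i..j}. fst (fl ! i) \<le> fst (fl ! s)))"
proof (cases "length fl = length p")
  case True
  have e: "map fst fl = map (\<lambda>s. fst (fl ! s)) [0..<length p] @ []"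
    by (rule nth_equalityI) (simp_all add: True)
  have "nested p [0] (map fst fl) \<longleftrightarrow> 
     (\<forall>i j. matched p i j \<longrightarrow> fst (fl ! i) = fst (fl ! j) \<and> (\<forall>s\<in>{i..j}. fst (fl ! i) \<le> fst (fl ! s)))"
    unfolding e
    using nested_forest[OF dyck_path_segment[OF assms], of "[]" 0 "[]" "\<lambda>s. fst (fl ! s)" "[]"]
      word_plane_forest[OF assms]
    by (auto simp: plane_forest_def matched_iff)
  then show ?thesis unfolding filling_iff_nested using True by blast
qed (simp add: filling_iff_nested)

text \<open>Every crossing number pushed by an up step is popped by a down step, and the numbers open at the
  start are popped in addition.\<close>

lemma filling_weight:
  "filling p st x fl \<Longrightarrow>
     2 * weight p fl + sum_list (map fst fl) = 2 * sum_list (map snd fl) + sum_list st"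
  by (induction p st x fl rule: filling.induct) auto

section \<open>Cells by column and level\<close>

text \<open>The cell at level \<open>k\<close> of column \<open>c\<close>: its center lies on the antidiagonal of the \<open>c\<close>-th
  point of the path, and level 0 is the first cell above that point.\<close>

definition level_cell :: "step list \<Rightarrow> nat \<Rightarrow> nat \<Rightarrow> cell" where
  "level_cell p k c = (fst (point p c) - 1 - int k, snd (point p c) + int k)"

definition gap :: "step list \<Rightarrow> step list \<Rightarrow> nat \<Rightarrow> nat" where
  "gap lam mu c = nat (snd (point mu c) - snd (point lam c))"

lemma point_Suc:
  "k < length p \<Longrightarrow> point p (Suc k) =
     (fst (point p k) + (if p ! k = Up then 0 else 1), snd (point p k) + (if p ! k = Up then 1 else 0))"
  by (cases "p ! k") (auto simp: point_def take_Suc_conv_app_nth)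

lemma point_mono:
  assumes "c \<le> d"
  shows "fst (point p c) \<le> fst (point p d)" "snd (point p c) \<le> snd (point p d)"
proof -
  have "take d p = take c p @ take (d - c) (drop c p)" using assms by (metis le_add_diff_inverse take_add)
  then show "fst (point p c) \<le> fst (point p d)" "snd (point p c) \<le> snd (point p d)"
    by (simp_all add: point_def)
qed

text \<open>Along the path both coordinates increase, so a cell need only be compared with the point on its own
  antidiagonal.\<close>

lemma cell_above_iff:
  assumes "c \<le> length p" "fst z + snd z + 1 = int c"
  shows "cell_above p z \<longleftrightarrow> fst z + 1 \<le> fst (point p c)"
proof
  assume "cell_above p z"
  then obtain d where d: "d \<le> length p" "fst z + 1 \<le> fst (point p d)" "snd (point p d) \<le> snd z"
    by (auto simp: cell_above_def points_def split_beta)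
  show "fst z + 1 \<le> fst (point p c)"
    using d point_mono[of d c p] point_mono[of c d p] assms point_sum[OF assms(1)] by (cases "d \<le> c") auto
next
  assume "fst z + 1 \<le> fst (point p c)"
  then show "cell_above p z" using assms point_sum[OF assms(1)]
    by (auto simp: cell_above_def points_def split_beta intro!: bexI[of _ c])
qed

lemma cell_below_iff:
  assumes "c \<le> length p" "fst z + snd z + 1 = int c"
  shows "cell_below p z \<longleftrightarrow> fst (point p c) \<le> fst z"
proof
  assume "cell_below p z"
  then obtain d where d: "d \<le> length p" "fst (point p d) \<le> fst z" "snd z + 1 \<le> snd (point p d)"
    by (auto simp: cell_below_def points_def split_beta)
  show "fst (point p c) \<le> fst z"
    using d point_mono[of d c p] point_mono[of c d p] assms point_sum[OF assms(1)] by (cases "d \<le> c") auto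
next
  assume "fst (point p c) \<le> fst z"
  then show "cell_below p z" using assms point_sum[OF assms(1)]
    by (auto simp: cell_below_def points_def split_beta intro!: bexI[of _ c])
qed

lemma level_cell_sum: "c \<le> length p \<Longrightarrow> fst (level_cell p k c) + snd (level_cell p k c) + 1 = int c"
  using point_sum[of c p] by (simp add: level_cell_def)

lemma level_cell_height: "snd (level_cell p k c) - fst (level_cell p k c) = height p c + 1 + 2 * int k"
  by (simp add: level_cell_def height_def)

lemma level_cell_eq_iff:
  assumes "c \<le> length p" "d \<le> length p"
  shows "level_cell p k c = level_cell p l d \<longleftrightarrow> k = l \<and> c = d"
proof
  assume e: "level_cell p k c = level_cell p l d"
  then have "int c = int d" using level_cell_sum[OF assms(1)] level_cell_sum[OF assms(2)] by metis
  then have "c = d" by simp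
  then show "k = l \<and> c = d" using e by (simp add: level_cell_def)
qed simp

lemma cell_above_level_cell: "c \<le> length p \<Longrightarrow> cell_above p (level_cell p k c)"
  using cell_above_iff[OF _ level_cell_sum] by (simp add: level_cell_def)

lemma not_cell_below_level_cell: "c \<le> length p \<Longrightarrow> \<not> cell_below p (level_cell p k c)"
  using cell_below_iff[OF _ level_cell_sum] by (simp add: level_cell_def)

definition shift_cell :: "cell \<Rightarrow> cell" where "shift_cell = (\<lambda>(a, b). (a + 1, b - 1))"

lemma shift_tile_eq: "shift_tile t = shift_cell ` t"
  by (simp add: shift_tile_def shift_cell_def)

lemma shift_level_cell_Suc: "shift_cell (level_cell p (Suc k) c) = level_cell p k c"
  by (simp add: shift_cell_def level_cell_def)

lemma shift_level_cell_0:
  assumes "c \<le> length p"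
  shows "cell_below p (shift_cell (level_cell p 0 c))" "\<not> cell_above p (shift_cell (level_cell p 0 c))"
proof -
  have s: "fst (shift_cell (level_cell p 0 c)) + snd (shift_cell (level_cell p 0 c)) + 1 = int c"
    using point_sum[OF assms] by (simp add: level_cell_def shift_cell_def)
  show "cell_below p (shift_cell (level_cell p 0 c))" "\<not> cell_above p (shift_cell (level_cell p 0 c))"
    unfolding cell_below_iff[OF assms s] cell_above_iff[OF assms s]
    by (simp_all add: level_cell_def shift_cell_def)
qed

lemma region_eq:
  assumes lam: "dyck_path n lam" and mu: "dyck_path n mu"
  shows "region lam mu = {level_cell lam k c | k c. c \<le> length lam \<and> k < gap lam mu c}"
    (is "_ = ?R")
proof
  have len: "length mu = length lam" using lam mu by (simp add: dyck_path_def)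
  show "region lam mu \<subseteq> ?R"
  proof
    fix z assume z: "z \<in> region lam mu"
    then obtain d e where d: "d \<le> length lam" "fst z + 1 \<le> fst (point lam d)" "snd (point lam d) \<le> snd z"
      and e: "e \<le> length mu" "fst (point mu e) \<le> fst z" "snd z + 1 \<le> snd (point mu e)"
      by (auto simp: region_def cell_above_def cell_below_def points_def split_beta)
    have nn: "0 \<le> fst (point p j)" "0 \<le> snd (point p j)" for p j by (auto simp: point_def)
    have "0 \<le> fst z + snd z + 1" using d e nn[of lam d] nn[of mu e] by linarith
    moreover have "fst z + snd z + 1 \<le> int (length lam)"
      using d e point_mono(1)[of d "length lam" lam] point_mono(2)[of e "length mu" mu] lam mu
      by (simp add: dyck_path_def)
    ultimately obtain c where c: "c \<le> length lam" "fst z + snd z + 1 = int c"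
      by (metis nonneg_int_cases of_nat_le_iff)
    have a: "fst z + 1 \<le> fst (point lam c)" "fst (point mu c) \<le> fst z"
      using z cell_above_iff[OF c] cell_below_iff[of c mu z] c len by (auto simp: region_def)
    define k where "k = nat (fst (point lam c) - 1 - fst z)"
    have "z = level_cell lam k c"
      using a c point_sum[OF c(1)] by (auto simp: level_cell_def k_def prod_eq_iff)
    moreover have "k < gap lam mu c"
      using a c point_sum[OF c(1)] point_sum[of c mu] len by (auto simp: gap_def k_def)
    ultimately show "z \<in> ?R" using c by blast
  qed
  show "?R \<subseteq> region lam mu"
  proof
    fix z assume "z \<in> ?R"
    then obtain k c where c: "c \<le> length lam" "k < gap lam mu c" and z: "z = level_cell lam k c" by blast
    have "fst (point mu c) \<le> fst (level_cell lam k c)"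
      using c len point_sum[of c lam] point_sum[of c mu] by (auto simp: gap_def level_cell_def)
    then have "cell_below mu (level_cell lam k c)"
      using cell_below_iff[of c mu, OF _ level_cell_sum] c len by simp
    then show "z \<in> region lam mu"
      using cell_above_level_cell c z by (simp add: region_def)
  qed
qed

definition strip :: "step list \<Rightarrow> nat \<Rightarrow> nat \<Rightarrow> nat \<Rightarrow> cell set" where
  "strip p k l r = level_cell p k ` {l..r}"

lemma level_cell_in_strip:
  "c \<le> length p \<Longrightarrow> r \<le> length p \<Longrightarrow> level_cell p j c \<in> strip p k l r \<longleftrightarrow> j = k \<and> l \<le> c \<and> c \<le> r"
  by (auto simp: strip_def level_cell_eq_iff)

text \<open>The lower left corners of the cells form a translate of the path between \<open>l\<close> and \<open>r\<close>: sum and difference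
  of the coordinates agree.\<close>

lemma dyck_tile_strip:
  assumes "dyck_segment p l r"
  shows "dyck_tile (strip p k l r)"
proof -
  have lr: "l \<le> r" "r \<le> length p" using assms by (auto simp: dyck_segment_def)
  define w where "w = take (r - l) (drop l p)"
  obtain m where m: "dyck_path m w" using dyck_segment_iff[OF lr] assms by (auto simp: w_def)
  have lw: "length w = r - l" using lr by (simp add: w_def)
  obtain a b where ab: "level_cell p k l = (a, b)" by fastforce
  have cell: "level_cell p k (l + u) = (a + fst (point w u), b + snd (point w u))" if u: "u \<le> r - l" for u
  proof -
    have "l + u \<le> length p" using u lr by linarith
    then have "fst (level_cell p k (l + u)) + snd (level_cell p k (l + u)) = a + b + (fst (point w u) + snd (point w u))"
      using level_cell_sum[of "l + u" p k] level_cell_sum[of l p k] ab point_sum[of u w] u lr lw by auto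
    moreover have "snd (level_cell p k (l + u)) - fst (level_cell p k (l + u))
        = b - a + (snd (point w u) - fst (point w u))"
    proof -
      have "height w u = height p (l + u) - height p l" using height_segment[OF lr u] by (simp add: w_def)
      then show ?thesis using level_cell_height[of p k "l + u"] level_cell_height[of p k l] ab
        by (simp add: height_def[of w])
    qed
    ultimately show ?thesis by (auto simp: prod_eq_iff)
  qed
  have "strip p k l r = (\<lambda>u. level_cell p k (l + u)) ` {..r - l}"
  proof -
    have "{l..r} = (\<lambda>u. l + u) ` {..r - l}" 
      using image_add_atLeastAtMost[of l 0 "r - l"] lr by (simp add: atLeast0AtMost add.commute)
    then show ?thesis by (simp add: strip_def image_image)
  qed
  also have "\<dots> = (\<lambda>(x, y). (a + x, b + y)) ` points w"
    using cell lw by (auto simp: points_def image_image split_beta)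
  finally show ?thesis using m unfolding dyck_tile_def by blast
qed

lemma dyck_tile_level:
  assumes "dyck_tile t" "t = level_cell p k ` C" "C \<subseteq> {..length p}"
  obtains l r where "t = strip p k l r" "dyck_segment p l r"
proof -
  obtain m w a b where w: "dyck_path m w" and t: "t = (\<lambda>(x, y). (a + x, b + y)) ` points w"
    using assms(1) by (auto simp: dyck_tile_def)
  have ht: "height w (length w) = 0" "\<And>u. u \<le> length w \<Longrightarrow> 0 \<le> height w u"
    using dyck_path_height w by blast+
  have ex: "\<exists>c\<in>C. (a + fst (point w u), b + snd (point w u)) = level_cell p k c" if "u \<le> length w" for u
  proof -
    have "(a + fst (point w u), b + snd (point w u)) \<in> t"
      using that by (auto simp: t points_def split_beta)
    then show ?thesis using assms(2) by blast
  qed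
  obtain l where l: "l \<in> C" "(a, b) = level_cell p k l" using ex[of 0] by (auto simp: point_def)
  have lp: "l \<le> length p" using l assms(3) by auto
  have cell: "(a + fst (point w u), b + snd (point w u)) = level_cell p k (l + u) \<and> l + u \<le> length p
      \<and> height w u = height p (l + u) - height p l" if u: "u \<le> length w" for u
  proof -
    obtain c where c: "c \<in> C" "(a + fst (point w u), b + snd (point w u)) = level_cell p k c"
      using ex[OF u] by blast
    then have cp: "c \<le> length p" using assms(3) by auto
    have "int c = int (l + u)"
      using level_cell_sum[OF cp, of k] level_cell_sum[OF lp, of k] point_sum[OF u]
      by (simp flip: c(2) l(2))
    then have cu: "c = l + u" by simp
    have "height w u = height p c - height p l"
      using level_cell_height[of p k c] level_cell_height[of p k l]
      by (simp add: height_def[of w] flip: c(2) l(2))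
    then show ?thesis using c cp cu by simp
  qed
  define r where "r = l + length w"
  have "dyck_segment p l r"
    unfolding dyck_segment_def
  proof (intro conjI ballI)
    show "height p l \<le> height p c" if "c \<in> {l..r}" for c
    proof -
      have "c - l \<le> length w" "l + (c - l) = c" using that by (auto simp: r_def)
      then show ?thesis using cell[of "c - l"] ht(2)[of "c - l"] by simp
    qed
  qed (use cell[of "length w"] ht(1) in \<open>simp_all add: r_def\<close>)
  moreover have "t = strip p k l r"
  proof -
    have "t = (\<lambda>u. (a + fst (point w u), b + snd (point w u))) ` {..length w}"
      by (auto simp: t points_def image_image split_beta)
    also have "\<dots> = (\<lambda>u. level_cell p k (l + u)) ` {..length w}"
      using cell by (intro image_cong) auto
    also have "\<dots> = level_cell p k ` {l..r}"
    proof -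
      have "{l..r} = (\<lambda>u. l + u) ` {..length w}" 
        using image_add_atLeastAtMost[of l 0 "length w"] by (simp add: r_def atLeast0AtMost add.commute)
      then show ?thesis by (simp add: image_image)
    qed
    finally show ?thesis by (simp add: strip_def)
  qed
  ultimately show ?thesis using that by blast
qed

section \<open>The shape of the tiles\<close>

lemma dyck_tilings_iff:
  "(mu, D) \<in> dyck_tilings n lam \<longleftrightarrow> dyck_path n mu \<and> weakly_above mu lam \<and> dyck_tiling lam mu D"
  by (simp add: dyck_tilings_def)

lemma snd_point_gap:
  assumes "weakly_above mu lam" "c \<le> length lam"
  shows "snd (point mu c) = snd (point lam c) + int (gap lam mu c)"
  using assms by (auto simp: gap_def weakly_above_def)

lemma level_cell_in_region:
  assumes "dyck_path n lam" "dyck_path n mu" "c \<le> length lam"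
  shows "level_cell lam k c \<in> region lam mu \<longleftrightarrow> k < gap lam mu c"
  using assms(3) by (auto simp: region_eq[OF assms(1,2)] level_cell_eq_iff)

lemma level_cell_in_shift_tile: "level_cell p (Suc k) c \<in> t \<Longrightarrow> level_cell p k c \<in> shift_tile t"
  by (metis shift_tile_eq shift_level_cell_Suc imageI)

lemma dyck_tiling_cover:
  assumes "dyck_tiling lam mu D" "t \<in> D" "z \<in> shift_tile t" "\<not> cell_below lam z"
  obtains t' where "t' \<in> D" "shift_tile t \<subseteq> t'"
  using assms unfolding dyck_tiling_def cover_inclusive_def by metis

text \<open>Induction on the level of a cell of the tile.  Such a cell at level 0 has its translate below the path, so
  the whole tile does, which puts all its cells at level 0.  A cell at level \<open>k + 1\<close> has its
  translate above the path, so the translated tile is contained in a tile that lies entirely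
  at level \<open>k\<close>.\<close>

lemma tile_eq_strip:
  assumes lam: "dyck_path n lam" and D: "(mu, D) \<in> dyck_tilings n lam" and t: "t \<in> D"
  obtains k l r where "t = strip lam k l r" "dyck_segment lam l r"
proof -
  have mu: "dyck_path n mu" and T: "dyck_tiling lam mu D" using D by (simp_all add: dyck_tilings_iff)
  have reg: "\<Union>D = {level_cell lam k c | k c. c \<le> length lam \<and> k < gap lam mu c}"
    using T region_eq[OF lam mu] by (simp add: dyck_tiling_def)
  have tile: "dyck_tile s" if "s \<in> D" for s using T that by (simp add: dyck_tiling_def)
  have level: "\<exists>C l r. t = level_cell lam k ` C \<and> C \<subseteq> {..length lam} \<and> t = strip lam k l r \<and> dyck_segment lam l r"
    if "t \<in> D" "level_cell lam k c \<in> t" "c \<le> length lam" for k c t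
    using that
  proof (induction k arbitrary: t c)
    case (0 t c)
    have "\<not> (\<exists>t'\<in>D. shift_tile t \<subseteq> t')"
    proof
      assume "\<exists>t'\<in>D. shift_tile t \<subseteq> t'"
      then have "shift_cell (level_cell lam 0 c) \<in> \<Union>D" using 0 by (auto simp: shift_tile_eq)
      moreover have "\<Union>D = region lam mu" using T by (simp only: dyck_tiling_def)
      ultimately have "cell_above lam (shift_cell (level_cell lam 0 c))"
        by (simp only: region_def mem_Collect_eq)
      then show False using shift_level_cell_0 0 by blast
    qed
    then have below: "\<forall>z\<in>t. cell_below lam (shift_cell z)"
      using T 0 by (auto simp: dyck_tiling_def cover_inclusive_def shift_tile_eq)
    have "\<exists>d\<le>length lam. z = level_cell lam 0 d" if z: "z \<in> t" for z
    proof -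
      obtain j d where jd: "z = level_cell lam j d" "d \<le> length lam"
        using z 0 reg by blast
      have "j = 0"
      proof (cases j)
        case (Suc i)
        then have "cell_below lam (level_cell lam i d)" using below z jd by (auto simp: shift_level_cell_Suc)
        then show ?thesis using not_cell_below_level_cell jd by blast
      qed
      then show ?thesis using jd by blast
    qed
    then have e: "t = level_cell lam 0 ` {d. d \<le> length lam \<and> level_cell lam 0 d \<in> t}" by blast
    obtain l r where "t = strip lam 0 l r" "dyck_segment lam l r"
      by (rule dyck_tile_level[OF tile[OF 0(1)] e]) auto
    then show ?case using e by blast
  next
    case (Suc k t c)
    note sh = level_cell_in_shift_tile[OF Suc.prems(2)]
    obtain t' where t': "t' \<in> D" "shift_tile t \<subseteq> t'"
      using dyck_tiling_cover[OF T Suc.prems(1) sh] not_cell_below_level_cell Suc.prems(3) by blast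
    then have "level_cell lam k c \<in> t'" using sh by blast
    from Suc.IH[OF t'(1) this Suc.prems(3)]
    obtain C where C: "t' = level_cell lam k ` C" "C \<subseteq> {..length lam}" by blast
    have "\<exists>d\<le>length lam. z = level_cell lam (Suc k) d" if z: "z \<in> t" for z
    proof -
      obtain d where d: "d \<in> C" "shift_cell z = level_cell lam k d"
        using t'(2) C z by (auto simp: shift_tile_eq)
      then have "z = level_cell lam (Suc k) d"
        by (auto simp: shift_cell_def level_cell_def split_beta prod_eq_iff)
      then show ?thesis using d C by auto
    qed
    then have e: "t = level_cell lam (Suc k) ` {d. d \<le> length lam \<and> level_cell lam (Suc k) d \<in> t}" by blast
    obtain l r where "t = strip lam (Suc k) l r" "dyck_segment lam l r"
      by (rule dyck_tile_level[OF tile[OF Suc(2)] e]) auto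
    then show ?case using e by blast
  qed
  have "t \<noteq> {}" using tile[OF t] by (auto simp: dyck_tile_def points_def)
  then obtain z where "z \<in> t" by blast
  moreover from this have "z \<in> \<Union>D" using t by blast
  ultimately obtain k c where "level_cell lam k c \<in> t" "c \<le> length lam" unfolding reg by blast
  from level[OF t this] show ?thesis using that by blast
qed

section \<open>From tilings to fillings\<close>

definition joined :: "step list \<Rightarrow> cell set set \<Rightarrow> nat \<Rightarrow> nat \<Rightarrow> bool" where
  "joined lam D k s \<longleftrightarrow> (\<exists>t\<in>D. level_cell lam k s \<in> t \<and> level_cell lam k (Suc s) \<in> t)"

definition crossings :: "step list \<Rightarrow> cell set set \<Rightarrow> nat \<Rightarrow> nat" where
  "crossings lam D s = card {k. joined lam D k s}"

lemma down_closed_eq_lessThan: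
  fixes X :: "nat set"
  assumes "finite X" "\<And>k. Suc k \<in> X \<Longrightarrow> k \<in> X"
  shows "X = {..<card X}"
proof -
  define m where "m = (LEAST m. m \<notin> X)"
  have "\<exists>m. m \<notin> X" using assms(1) by (metis ex_new_if_finite infinite_UNIV_nat)
  then have m: "m \<notin> X" unfolding m_def by (rule LeastI_ex)
  have "k \<notin> X" if "m \<le> k" for k
    using that by (induction k rule: dec_induct) (use m assms(2) in blast)+
  moreover have "k \<in> X" if "k < m" for k using that not_less_Least unfolding m_def by blast
  ultimately have "k \<in> X \<longleftrightarrow> k < m" for k by (cases "k < m") auto
  then have "X = {..<m}" by auto
  then show ?thesis by simp
qed

text \<open>If a step is crossed at level \<open>k + 1\<close>, then it is also crossed at level \<open>k\<close>, because the translate of the tile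
  lies inside another tile.  So it suffices to count the crossings.\<close>

lemma joined_iff:
  assumes lam: "dyck_path n lam" and D: "(mu, D) \<in> dyck_tilings n lam" and s: "s < length lam"
  shows "joined lam D k s \<longleftrightarrow> k < crossings lam D s"
proof -
  have mu: "dyck_path n mu" and T: "dyck_tiling lam mu D" using D by (simp_all add: dyck_tilings_iff)
  have U: "\<Union>D = region lam mu" using T by (simp only: dyck_tiling_def)
  have "{k. joined lam D k s} \<subseteq> {..<gap lam mu s}"
    using level_cell_in_region[OF lam mu, of s] s unfolding U[symmetric] by (auto simp: joined_def)
  then have fin: "finite {k. joined lam D k s}" by (rule finite_subset) simp
  have "joined lam D k s" if j: "joined lam D (Suc k) s" for k
  proof -
    obtain t where t: "t \<in> D" "level_cell lam (Suc k) s \<in> t" "level_cell lam (Suc k) (Suc s) \<in> t"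
      using j by (auto simp: joined_def)
    then have sh: "level_cell lam k s \<in> shift_tile t" "level_cell lam k (Suc s) \<in> shift_tile t"
      by (simp_all add: level_cell_in_shift_tile)
    obtain t' where "t' \<in> D" "shift_tile t \<subseteq> t'"
      using dyck_tiling_cover[OF T t(1) sh(1)] not_cell_below_level_cell[of s lam k] s by auto
    then show ?thesis using sh by (auto simp: joined_def)
  qed
  then have "{k. joined lam D k s} = {..<crossings lam D s}"
    unfolding crossings_def using fin by (intro down_closed_eq_lessThan) auto
  then show ?thesis by blast
qed

definition tiling_filling :: "step list \<Rightarrow> step list \<times> cell set set \<Rightarrow> (nat \<times> nat) list" where
  "tiling_filling lam T = map (\<lambda>s. (crossings lam (snd T) s, gap lam (fst T) (Suc s))) [0..<length lam]"

lemma gap_0: "gap lam mu 0 = 0"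
  by (simp add: gap_def point_def)

lemma levels_tiling_filling:
  "c \<le> length lam \<Longrightarrow> levels 0 (tiling_filling lam (mu, D)) c = gap lam mu c"
  by (cases c) (auto simp: levels_def tiling_filling_def gap_0)

text \<open>The conditions on matched steps hold because a tile covers a Dyck segment: if it crosses one step of a matched pair,
  then it also crosses the partner and all steps between.\<close>

lemma filling_tiling_filling:
  assumes lam: "dyck_path n lam" and D: "(mu, D) \<in> dyck_tilings n lam"
  shows "filling lam [0] 0 (tiling_filling lam (mu, D))"
proof -
  have mu: "dyck_path n mu" "weakly_above mu lam" and T: "dyck_tiling lam mu D"
    using D by (simp_all add: dyck_tilings_iff)
  have U: "\<Union>D = region lam mu" using T by (simp only: dyck_tiling_def)
  have len: "length mu = length lam" using mu by (simp add: weakly_above_def)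
  have fst: "fst (tiling_filling lam (mu, D) ! s) = crossings lam D s" if "s < length lam" for s
    using that by (simp add: tiling_filling_def)
  have lev: "level_step (lam ! s) (gap lam mu s) (crossings lam D s) (gap lam mu (Suc s))"
    if s: "s < length lam" for s
  proof -
    have g: "snd (point mu s) = snd (point lam s) + int (gap lam mu s)"
      "snd (point mu (Suc s)) = snd (point lam (Suc s)) + int (gap lam mu (Suc s))"
      using snd_point_gap[OF mu(2)] s by simp_all
    have "k < gap lam mu s \<and> k < gap lam mu (Suc s)" if "k < crossings lam D s" for k
    proof -
      have "joined lam D k s" using joined_iff[OF lam D s] that by simp
      then have "level_cell lam k s \<in> region lam mu" "level_cell lam k (Suc s) \<in> region lam mu"
        unfolding U[symmetric] joined_def by auto
      then show ?thesis using level_cell_in_region[OF lam mu(1)] s by simp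
    qed
    then have "crossings lam D s \<le> min (gap lam mu s) (gap lam mu (Suc s))"
      by (metis min.boundedI not_le nless_le order.irrefl)
    then show ?thesis
      using g s len unfolding level_step_def point_Suc[OF s]
      by (cases "lam ! s"; cases "mu ! s") (simp_all add: point_Suc)
  qed
  have mt: "crossings lam D i = crossings lam D j \<and> (\<forall>s\<in>{i..j}. crossings lam D i \<le> crossings lam D s)"
    if m: "matched lam i j" for i j
  proof -
    have ij: "i < j" "j < length lam" using m by (auto simp: matched_iff)
    have seg: "\<exists>l r. dyck_segment lam l r \<and> l \<le> c \<and> c < r \<and> (\<forall>s. l \<le> s \<and> s < r \<longrightarrow> joined lam D k s)"
      if jc: "joined lam D k c" "c < length lam" for c k
    proof -
      obtain t where t: "t \<in> D" "level_cell lam k c \<in> t" "level_cell lam k (Suc c) \<in> t"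
        using jc by (auto simp: joined_def)
      obtain k' l r where t': "t = strip lam k' l r" "dyck_segment lam l r"
        using tile_eq_strip[OF lam D t(1)] by blast
      have r: "r \<le> length lam" using t' by (simp add: dyck_segment_def)
      have "k' = k" "l \<le> c" "Suc c \<le> r"
        using t t' r jc level_cell_in_strip[of c lam r] level_cell_in_strip[of "Suc c" lam r] by auto
      moreover have "joined lam D k s" if "l \<le> s" "s < r" for s
        unfolding joined_def using t(1) t'(1) \<open>k' = k\<close> that by (auto simp: strip_def intro!: bexI[of _ t])
      ultimately show ?thesis using t'(2) by (intro exI[of _ l] exI[of _ r]) simp
    qed
    have up: "joined lam D k s" if up: "joined lam D k i" "i \<le> s" "s \<le> j" for k s
    proof -
      obtain l r where lr: "dyck_segment lam l r" "l \<le> i" "i < r" "\<forall>s. l \<le> s \<and> s < r \<longrightarrow> joined lam D k s"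
        using seg[OF up(1)] ij by auto
      then have "j < r" using matched_within_segment(1)[OF m lr(1)] by blast
      then show ?thesis using lr up by simp
    qed
    have down: "joined lam D k i" if down: "joined lam D k j" for k
    proof -
      obtain l r where lr: "dyck_segment lam l r" "l \<le> j" "j < r" "\<forall>s. l \<le> s \<and> s < r \<longrightarrow> joined lam D k s"
        using seg[OF down] ij by auto
      then have "l \<le> i" using matched_within_segment(2)[OF m lr(1)] by blast
      then show ?thesis using lr ij by simp
    qed
    have "crossings lam D i \<le> crossings lam D s" if "s \<in> {i..j}" for s
      using up joined_iff[OF lam D, of i] joined_iff[OF lam D, of s] that ij by (metis atLeastAtMost_iff
        le_less_trans not_le order.irrefl order.strict_trans)
    moreover have "crossings lam D j \<le> crossings lam D i"
      using down joined_iff[OF lam D, of i] joined_iff[OF lam D, of j] ij by (metis not_le order.irrefl order.strict_trans)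
    ultimately show ?thesis using ij by (simp add: order.antisym)
  qed
  have "gap lam mu (length lam) = 0"
    using lam mu(1) by (simp add: gap_def dyck_path_def)
  then show ?thesis
    unfolding filling_iff[OF lam] using lev mt fst levels_tiling_filling
    by (auto simp: matched_iff tiling_filling_def levels_tiling_filling)
qed

lemma path_eqI:
  assumes "length p = length r" "\<And>c. c \<le> length p \<Longrightarrow> snd (point p c) = snd (point r c)"
  shows "p = r"
proof (rule nth_equalityI)
  fix s assume s: "s < length p"
  then have "(if p ! s = Up then 1 else 0 :: int) = (if r ! s = Up then 1 else 0)"
    using assms(2)[of s] assms(2)[of "Suc s"] assms(1) by (simp add: point_Suc)
  then show "p ! s = r ! s" by (cases "p ! s"; cases "r ! s") auto
qed (use assms in simp)

lemma tile_unique: "disjoint D \<Longrightarrow> t \<in> D \<Longrightarrow> t' \<in> D \<Longrightarrow> z \<in> t \<Longrightarrow> z \<in> t' \<Longrightarrow> t = t'"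
  by (auto simp: disjoint_def)

text \<open>Follow the tile from its left end: at each step the cells before and after it are joined in one
  tiling iff they are in the other.\<close>

lemma tiles_subset_if_same_filling:
  assumes lam: "dyck_path n lam" and D: "(mu, D) \<in> dyck_tilings n lam" and D': "(mu, D') \<in> dyck_tilings n lam"
    and cr: "\<And>s. s < length lam \<Longrightarrow> crossings lam D s = crossings lam D' s" and t: "t \<in> D"
  shows "\<exists>t'\<in>D'. t \<subseteq> t'"
proof -
  have T: "dyck_tiling lam mu D" "dyck_tiling lam mu D'" using D D' by (simp_all add: dyck_tilings_iff)
  obtain k l r where tk: "t = strip lam k l r" "dyck_segment lam l r" using tile_eq_strip[OF lam D t] by blast
  then have lr: "l \<le> r" "r \<le> length lam" by (auto simp: dyck_segment_def)
  have "level_cell lam k l \<in> t" using tk lr by (auto simp: strip_def)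
  moreover have "\<Union>D = \<Union>D'" using T by (simp only: dyck_tiling_def)
  ultimately obtain t' where t': "t' \<in> D'" "level_cell lam k l \<in> t'"
    using t by blast
  have "level_cell lam k c \<in> t'" if "l \<le> c" "c \<le> r" for c
    using that
  proof (induction c rule: dec_induct)
    case (step c)
    have "joined lam D k c"
      unfolding joined_def using t tk step by (auto simp: strip_def intro!: bexI[of _ t])
    then have "joined lam D' k c" using joined_iff[OF lam D] joined_iff[OF lam D'] cr step lr by simp
    then obtain t'' where t'': "t'' \<in> D'" "level_cell lam k c \<in> t''" "level_cell lam k (Suc c) \<in> t''"
      by (auto simp: joined_def)
    moreover have "level_cell lam k c \<in> t'" using step by simp
    ultimately have "t'' = t'" using tile_unique t' T(2) by (metis dyck_tiling_def)
    then show ?case using t'' by simp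
  qed (use t' in simp)
  then show ?thesis using t' tk by (intro bexI[of _ t']) (auto simp: strip_def)
qed

lemma tiles_eq_if_same_filling:
  assumes lam: "dyck_path n lam" and D: "(mu, D) \<in> dyck_tilings n lam" and D': "(mu, D') \<in> dyck_tilings n lam"
    and cr: "\<And>s. s < length lam \<Longrightarrow> crossings lam D s = crossings lam D' s"
  shows "D \<subseteq> D'"
proof
  fix t assume t: "t \<in> D"
  obtain t' where t': "t' \<in> D'" "t \<subseteq> t'"
    using tiles_subset_if_same_filling[OF lam D D' cr t] by blast
  obtain t'' where t'': "t'' \<in> D" "t' \<subseteq> t''"
    using tiles_subset_if_same_filling[OF lam D' D _ t'(1)] cr by metis
  have "dyck_tile t" "disjoint D" using D t by (auto simp: dyck_tilings_iff dyck_tiling_def)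
  then have "t \<noteq> {}" by (auto simp: dyck_tile_def points_def)
  then have "t = t''" using tile_unique[OF \<open>disjoint D\<close> t t''(1)] t' t'' by blast
  then show "t \<in> D'" using t' t'' by auto
qed

lemma inj_tiling_filling:
  assumes lam: "dyck_path n lam"
  shows "inj_on (tiling_filling lam) (dyck_tilings n lam)"
proof (rule inj_onI, clarify)
  fix mu D mu' D'
  assume D: "(mu, D) \<in> dyck_tilings n lam" and D': "(mu', D') \<in> dyck_tilings n lam"
    and e: "tiling_filling lam (mu, D) = tiling_filling lam (mu', D')"
  have w: "weakly_above mu lam" "weakly_above mu' lam" using D D' by (simp_all add: dyck_tilings_iff)
  have cr: "crossings lam D s = crossings lam D' s" if "s < length lam" for s
    using arg_cong[OF e, of "\<lambda>fl. fst (fl ! s)"] that by (simp add: tiling_filling_def)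
  have gp: "gap lam mu c = gap lam mu' c" if "c \<le> length lam" for c
    using levels_tiling_filling[OF that] e by metis
  have mu: "mu = mu'"
    using snd_point_gap[OF w(1)] snd_point_gap[OF w(2)] gp w
    by (intro path_eqI) (auto simp: weakly_above_def)
  then have "D = D'"
    using tiles_eq_if_same_filling[OF lam D, of D'] tiles_eq_if_same_filling[OF lam, of mu D' D] D D' cr
    by (metis subset_antisym)
  then show "mu = mu' \<and> D = D'" using mu by simp
qed

text \<open>A tile crosses one step less than it has cells, so the number of tiles is the area minus the number of all
  crossings.  By \<open>filling_weight\<close> half of the crossings lie on up steps.\<close>

lemma art_eq_weight:
  assumes lam: "dyck_path n lam" and D: "(mu, D) \<in> dyck_tilings n lam"
  shows "art lam (mu, D) = weight lam (tiling_filling lam (mu, D))"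
proof -
  have mu: "dyck_path n mu" "weakly_above mu lam" and T: "dyck_tiling lam mu D"
    using D by (simp_all add: dyck_tilings_iff)
  have U: "\<Union>D = region lam mu" and dis: "disjoint D" and tile: "\<And>t. t \<in> D \<Longrightarrow> dyck_tile t"
    using T by (auto simp: dyck_tiling_def)
  have finD: "finite D" using U finite_region[of lam mu] finite_UnionD by metis
  let ?N = "length lam"
  have "region lam mu = (\<lambda>(c, k). level_cell lam k c) ` Sigma {..?N} (\<lambda>c. {..<gap lam mu c})"
    unfolding region_eq[OF lam mu(1)]
    by (auto simp: image_iff) (metis atMost_iff lessThan_iff)
  moreover have "inj_on (\<lambda>(c, k). level_cell lam k c) (Sigma {..?N} (\<lambda>c. {..<gap lam mu c}))"
    by (auto simp: inj_on_def level_cell_eq_iff)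
  ultimately have "card (region lam mu) = (\<Sum>c\<le>?N. gap lam mu c)"
    by (simp add: card_image)
  also have "\<dots> = (\<Sum>s<?N. gap lam mu (Suc s))"
    by (simp add: sum.atMost_shift gap_0)
  also have "\<dots> = sum_list (map snd (tiling_filling lam (mu, D)))"
    by (simp add: tiling_filling_def comp_def interv_sum_list_conv_sum_set_nat atLeast0LessThan)
  finally have area: "card (region lam mu) = sum_list (map snd (tiling_filling lam (mu, D)))" .
  define J where "J t = {(s, k). s < ?N \<and> level_cell lam k s \<in> t \<and> level_cell lam k (Suc s) \<in> t}" for t
  have J: "finite (J t)" "card t = Suc (card (J t))" if t: "t \<in> D" for t
  proof -
    obtain k l r where tk: "t = strip lam k l r" "dyck_segment lam l r" using tile_eq_strip[OF lam D t] by blast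
    then have lr: "l \<le> r" "r \<le> ?N" by (auto simp: dyck_segment_def)
    have "J t = {l..<r} \<times> {k}"
      using lr by (auto simp: J_def tk(1) level_cell_in_strip)
    moreover have "card t = Suc (r - l)"
      using lr unfolding tk(1) strip_def by (subst card_image) (auto simp: inj_on_def level_cell_eq_iff)
    ultimately show "finite (J t)" "card t = Suc (card (J t))" by simp_all
  qed
  have "(\<Union>t\<in>D. J t) = Sigma {..<?N} (\<lambda>s. {..<crossings lam D s})"
    using joined_iff[OF lam D] by (auto simp: J_def joined_def)
  then have "card (\<Union>t\<in>D. J t) = (\<Sum>s<?N. crossings lam D s)" by simp
  moreover have "J t \<inter> J t' = {}" if "t \<in> D" "t' \<in> D" "t \<noteq> t'" for t t'
    using tile_unique[OF dis that(1,2)] that(3) unfolding J_def by blast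
  then have "card (\<Union>t\<in>D. J t) = (\<Sum>t\<in>D. card (J t))"
    using J(1) finD by (intro card_UN_disjoint) auto
  ultimately have "(\<Sum>t\<in>D. card (J t)) = sum_list (map fst (tiling_filling lam (mu, D)))"
    by (simp add: tiling_filling_def comp_def interv_sum_list_conv_sum_set_nat atLeast0LessThan)
  moreover have "card (region lam mu) = (\<Sum>t\<in>D. card t)"
    using card_Union_disjoint[of D] dis tile dyck_tile_finite_odd(1)
    by (simp add: U[symmetric] disjoint_def pairwise_def disjnt_def)
  moreover have "(\<Sum>t\<in>D. card t) = (\<Sum>t\<in>D. card (J t)) + card D"
    using J(2) by (simp add: sum.distrib[symmetric] sum_Suc[symmetric])
  ultimately have "card D + sum_list (map fst (tiling_filling lam (mu, D))) = card (region lam mu)" by simp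
  moreover have "2 * weight lam (tiling_filling lam (mu, D)) + sum_list (map fst (tiling_filling lam (mu, D)))
     = 2 * card (region lam mu)"
    using filling_weight[OF filling_tiling_filling[OF lam D]] area by simp
  ultimately have "card (region lam mu) + card D = 2 * weight lam (tiling_filling lam (mu, D))" by linarith
  then show ?thesis by (simp add: art_def area_def tiles_def)
qed

section \<open>From fillings to tilings\<close>

text \<open>The path whose points lie \<open>m c\<close> above those of \<open>lam\<close>.\<close>

definition upper_path :: "step list \<Rightarrow> (nat \<Rightarrow> nat) \<Rightarrow> step list" where
  "upper_path lam m = map (\<lambda>s. if (lam ! s = Up) = (m (Suc s) = m s) then Up else Down) [0..<length lam]"

text \<open>The columns in \<open>{0..N}\<close> that can be reached from column \<open>c\<close> by steps crossed at level \<open>k\<close>.\<close>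

definition block :: "(nat \<Rightarrow> nat) \<Rightarrow> nat \<Rightarrow> nat \<Rightarrow> nat \<Rightarrow> nat set" where
  "block f N k c = {d. d \<le> N \<and> (\<forall>s. min c d \<le> s \<and> s < max c d \<longrightarrow> k < f s)}"

definition block_tiling :: "step list \<Rightarrow> (nat \<Rightarrow> nat) \<Rightarrow> (nat \<Rightarrow> nat) \<Rightarrow> cell set set" where
  "block_tiling lam f m = {level_cell lam k ` block f (length lam) k c | k c. c \<le> length lam \<and> k < m c}"

lemma block_refl: "c \<le> N \<Longrightarrow> c \<in> block f N k c"
  by (simp add: block_def)

lemma block_le: "d \<in> block f N k c \<Longrightarrow> d \<le> N"
  by (simp add: block_def)

lemma block_sym: "c \<le> N \<Longrightarrow> d \<in> block f N k c \<Longrightarrow> c \<in> block f N k d"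
  by (simp add: block_def min.commute max.commute)

lemma block_trans:
  assumes "d \<in> block f N k c" "e \<in> block f N k d" shows "e \<in> block f N k c"
proof -
  have "k < f s" if "min c e \<le> s" "s < max c e" for s
  proof -
    have "min c d \<le> s \<and> s < max c d \<or> min d e \<le> s \<and> s < max d e"
      using that by (auto simp: min_def max_def split: if_splits)
    then show ?thesis using assms by (auto simp: block_def)
  qed
  then show ?thesis using assms by (simp add: block_def)
qed

lemma block_eq:
  assumes "c \<le> N" "d \<in> block f N k c" shows "block f N k d = block f N k c"
  using block_trans[OF assms(2)] block_trans[OF block_sym[OF assms]] by blast

lemma block_interval:
  assumes "c \<le> N"
  obtains l r where "block f N k c = {l..r}" "l \<le> r" "r \<le> N" "\<forall>s. l \<le> s \<and> s < r \<longrightarrow> k < f s"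
    "\<forall>s. Suc s = l \<longrightarrow> f s \<le> k" "r < N \<longrightarrow> f r \<le> k"
proof -
  let ?B = "block f N k c"
  define l r where "l = Min ?B" and "r = Max ?B"
  have fin: "finite ?B" by (rule finite_subset[of _ "{..N}"]) (auto simp: block_def)
  have c: "c \<in> ?B" using block_refl assms .
  then have lB: "l \<in> ?B" and rB: "r \<in> ?B" unfolding l_def r_def using fin by (auto intro: Min_in Max_in)
  have lc: "l \<le> c" "c \<le> r" unfolding l_def r_def using fin c by auto
  have inside: "k < f s" if "l \<le> s" "s < r" for s
  proof (cases "s < c")
    case True then show ?thesis using lB lc that by (auto simp: block_def)
  next
    case False then show ?thesis using rB lc that by (auto simp: block_def)
  qed
  have "?B = {l..r}"
  proof
    show "?B \<subseteq> {l..r}" unfolding l_def r_def using fin by auto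
    show "{l..r} \<subseteq> ?B" using inside block_le[OF rB] lc by (auto simp: block_def)
  qed
  moreover have "f s \<le> k" if "Suc s = l" for s
  proof (rule ccontr)
    assume "\<not> f s \<le> k"
    then have "k < f s'" if "s \<le> s'" "s' < c" for s'
      using inside[of s'] that \<open>Suc s = l\<close> lc by (cases "s' = s") auto
    then have "s \<in> ?B" using that lc assms by (auto simp: block_def)
    then have "l \<le> s" unfolding l_def using fin by simp
    then show False using that by simp
  qed
  moreover have "f r \<le> k" if "r < N"
  proof (rule ccontr)
    assume "\<not> f r \<le> k"
    then have "k < f s'" if "c \<le> s'" "s' < Suc r" for s'
      using inside[of s'] that lc by (cases "s' = r") auto
    then have "Suc r \<in> ?B" using that lc by (auto simp: block_def)
    then have "Suc r \<le> r" unfolding r_def using fin by simp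
    then show False by simp
  qed
  ultimately show ?thesis using that inside lc block_le[OF rB] le_trans by blast
qed

text \<open>The tiles are the blocks at each level.  A block is a maximal interval of columns whose steps are crossed more than \<open>k\<close> times; the
  conditions on matched steps make it closed under taking partners, hence a Dyck segment.  Blocks
  grow as the level decreases, which gives cover-inclusiveness.\<close>

lemma filling_is_tiling_filling:
  assumes lam: "dyck_path n lam" and fl: "filling lam [0] 0 fl"
  shows "\<exists>T\<in>dyck_tilings n lam. tiling_filling lam T = fl"
proof -
  let ?N = "length lam"
  define f where "f s = fst (fl ! s)" for s
  define m where "m = levels 0 fl"
  have len: "length fl = ?N"
    and step: "\<And>s. s < ?N \<Longrightarrow> level_step (lam ! s) (m s) (f s) (m (Suc s))"
    and mN: "m ?N = 0"
    and matched: "\<forall>i j. matched lam i j \<longrightarrow> f i = f j \<and> (\<forall>s\<in>{i..j}. f i \<le> f s)"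
    using fl unfolding filling_iff[OF lam] f_def m_def by blast+
  have m0: "m 0 = 0" by (simp add: m_def levels_def)
  have match: "f i = f j" if "matched lam i j" for i j using matched that by blast
  have match': "f i \<le> f s" if "matched lam i j" "i \<le> s" "s \<le> j" for i j s
    using matched that by (meson atLeastAtMost_iff)
  have fm: "f s \<le> m s" "f s \<le> m (Suc s)" if "s < ?N" for s
    using step[OF that] by (auto simp: level_step_def)
  define mu where "mu = upper_path lam m"
  have lmu: "length mu = ?N" by (simp add: mu_def upper_path_def)
  have height: "snd (point mu c) = snd (point lam c) + int (m c)" if "c \<le> ?N" for c
    using that
  proof (induction c)
    case 0 then show ?case by (simp add: m0 point_def)
  next
    case (Suc c)
    then have c: "c < ?N" by simp
    have "mu ! c = (if (lam ! c = Up) = (m (Suc c) = m c) then Up else Down)"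
      using c by (simp add: mu_def upper_path_def)
    then show ?case using Suc.IH c step[OF c] lmu
      by (auto simp: point_Suc level_step_def)
  qed
  have above: "weakly_above mu lam" using height lmu by (simp add: weakly_above_def)
  have lN: "?N = 2 * n" using lam by (simp add: dyck_path_def)
  have path: "dyck_path n mu"
    unfolding dyck_path_def
  proof (intro conjI)
    show "point mu (2 * n) = (int n, int n)"
      using height[of ?N] mN lN point_sum[of ?N mu] lmu lam by (simp add: dyck_path_def prod_eq_iff)
    have "fst (point mu c) \<le> snd (point mu c)" if "c \<le> ?N" for c
    proof -
      have "point lam c \<in> points lam" using that by (simp add: points_def)
      then have "fst (point lam c) \<le> snd (point lam c)" using lam by (auto simp: dyck_path_def split_beta)
      then show ?thesis using height[OF that] point_sum[OF that] point_sum[of c mu] lmu that by simp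
    qed
    then show "\<forall>(x, y)\<in>points mu. x \<le> y" by (auto simp: points_def split_beta lmu)
  qed (simp add: lmu lN)
  have gap: "gap lam mu c = m c" if "c \<le> ?N" for c
    using height[OF that] by (simp add: gap_def)
  define D where "D = block_tiling lam f m"
  have mem: "level_cell lam j d \<in> level_cell lam k ` block f ?N k c \<longleftrightarrow> j = k \<and> d \<in> block f ?N k c"
    if "d \<le> ?N" for j d k c
    using that block_le[of _ f ?N k c] by (auto simp: level_cell_eq_iff)
  have m_block: "k < m d" if d: "d \<in> block f ?N k c" "k < m c" "c \<le> ?N" for c d k
  proof -
    consider "d = c" | "d < c" | s where "d = Suc s" "c \<le> s" by (metis less_Suc_eq_le linorder_neqE_nat not0_implies_Suc not_less_zero)
    then show ?thesis
    proof cases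
      case 2
      then have "k < f d" using d by (auto simp: block_def)
      then show ?thesis using fm(1)[of d] 2 d by simp
    next
      case 3
      then have "k < f s" "s < ?N" using d by (auto simp: block_def)
      then show ?thesis using fm(2)[of s] 3 by simp
    qed (use d in simp)
  qed
  have seg: "\<exists>l r. level_cell lam k ` block f ?N k c = strip lam k l r \<and> dyck_segment lam l r"
    if cN: "c \<le> ?N" for k c
  proof -
    obtain l r where lr: "block f ?N k c = {l..r}" "l \<le> r" "r \<le> ?N" "\<forall>s. l \<le> s \<and> s < r \<longrightarrow> k < f s"
        "\<forall>s. Suc s = l \<longrightarrow> f s \<le> k" "r < ?N \<longrightarrow> f r \<le> k"
      using block_interval[OF cN, of f k] by blast
    have "dyck_segment lam l r"
    proof (rule dyck_segment_if_closed[OF lam lr(2,3)])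
      fix i j assume ij: "matched lam i j"
      then have j: "i < j" "j < ?N" by (auto simp: matched_iff)
      show "l \<le> i \<and> i < r \<longleftrightarrow> l \<le> j \<and> j < r"
      proof
        assume i: "l \<le> i \<and> i < r"
        have "j < r"
        proof (rule ccontr)
          assume "\<not> j < r"
          then have "f i \<le> f r" "r < ?N" using match'[OF ij, of r] i j by auto
          then show False using lr(4)[rule_format, of i] lr(6) i by simp
        qed
        then show "l \<le> j \<and> j < r" using i j by simp
      next
        assume a: "l \<le> j \<and> j < r"
        have "l \<le> i"
        proof (rule ccontr)
          assume "\<not> l \<le> i"
          then obtain s where s: "Suc s = l" "i \<le> s" by (metis Suc_le_D not_less_eq_eq)
          then have "f i \<le> f s" using match'[OF ij, of s] a by simp
          then show False using lr(4)[rule_format, of j] lr(5)[rule_format, OF s(1)] match[OF ij] a by simp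
        qed
        then show "l \<le> i \<and> i < r" using a j by simp
      qed
    qed
    then show ?thesis using lr(1) by (auto simp: strip_def)
  qed
  have D_mem: "t \<in> D \<longleftrightarrow> (\<exists>k c. t = level_cell lam k ` block f ?N k c \<and> c \<le> ?N \<and> k < m c)" for t
    by (auto simp: D_def block_tiling_def)
  have "dyck_tiling lam mu D"
    unfolding dyck_tiling_def
  proof (intro conjI ballI)
    fix t assume "t \<in> D"
    then obtain k c where t: "t = level_cell lam k ` block f ?N k c" "c \<le> ?N" by (auto simp: D_mem)
    then show "dyck_tile t" using seg[OF t(2), of k] dyck_tile_strip by metis
  next
    show "disjoint D"
    proof (rule disjointI)
      fix t t' assume t: "t \<in> D" "t' \<in> D" "t \<noteq> t'"
      obtain k c where kc: "t = level_cell lam k ` block f ?N k c" "c \<le> ?N" using t by (auto simp: D_mem)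
      obtain j d where jd: "t' = level_cell lam j ` block f ?N j d" "d \<le> ?N" using t by (auto simp: D_mem)
      show "t \<inter> t' = {}"
      proof (rule ccontr)
        assume "t \<inter> t' \<noteq> {}"
        then obtain e where e: "e \<in> block f ?N k c" "level_cell lam k e \<in> t'" using kc by auto
        then have "k = j" "e \<in> block f ?N j d" using mem[of e] block_le[OF e(1)] jd by auto
        then have "block f ?N k c = block f ?N j d"
          using block_eq[OF kc(2) e(1)] block_eq[OF jd(2)] by metis
        then show False using t(3) kc jd \<open>k = j\<close> by simp
      qed
    qed
  next
    show "\<Union>D = region lam mu"
    proof
      show "\<Union>D \<subseteq> region lam mu"
      proof
        fix z assume "z \<in> \<Union>D"
        then obtain k c d where z: "z = level_cell lam k d" "d \<in> block f ?N k c" "c \<le> ?N" "k < m c"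
          by (auto simp: D_mem)
        then show "z \<in> region lam mu"
          using level_cell_in_region[OF lam path block_le[OF z(2)]] gap[OF block_le[OF z(2)]] m_block[OF z(2,4,3)]
          by simp
      qed
      show "region lam mu \<subseteq> \<Union>D"
      proof
        fix z assume "z \<in> region lam mu"
        then obtain k c where z: "z = level_cell lam k c" "c \<le> ?N" "k < m c"
          unfolding region_eq[OF lam path] using gap by auto
        then have "z \<in> level_cell lam k ` block f ?N k c" using block_refl by blast
        moreover have "level_cell lam k ` block f ?N k c \<in> D" using z D_mem by blast
        ultimately show "z \<in> \<Union>D" by blast
      qed
    qed
  next
    show "cover_inclusive lam D"
      unfolding cover_inclusive_def
    proof
      fix t assume "t \<in> D"
      then obtain k c where t: "t = level_cell lam k ` block f ?N k c" "c \<le> ?N" "k < m c" by (auto simp: D_mem)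
      show "(\<forall>z\<in>shift_tile t. cell_below lam z) \<or> (\<exists>t'\<in>D. t' \<noteq> t \<and> shift_tile t \<subseteq> t')"
      proof (cases k)
        case 0
        then have "\<forall>z\<in>shift_tile t. cell_below lam z"
          using shift_level_cell_0(1) block_le by (auto simp: t shift_tile_eq)
        then show ?thesis ..
      next
        case (Suc j)
        define t' where "t' = level_cell lam j ` block f ?N j c"
        have "t' \<in> D" using t Suc D_mem t'_def Suc_lessD by blast
        moreover have "level_cell lam k c \<in> t" "level_cell lam k c \<notin> t'"
          using t mem[OF t(2)] block_refl[OF t(2)] Suc by (auto simp: t'_def)
        moreover have "block f ?N k c \<subseteq> block f ?N j c" using Suc by (auto simp: block_def)
        then have "shift_tile t \<subseteq> t'"
          using Suc by (auto simp: t(1) t'_def shift_tile_eq shift_level_cell_Suc)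
        ultimately show ?thesis by blast
      qed
    qed
  qed
  then have T: "(mu, D) \<in> dyck_tilings n lam" using path above by (simp add: dyck_tilings_iff)
  have joined: "joined lam D k s \<longleftrightarrow> k < f s" if s: "s < ?N" for k s
  proof
    assume "joined lam D k s"
    then obtain t where t: "t \<in> D" "level_cell lam k s \<in> t" "level_cell lam k (Suc s) \<in> t"
      unfolding joined_def by blast
    then obtain j c where "level_cell lam k s \<in> level_cell lam j ` block f ?N j c"
        "level_cell lam k (Suc s) \<in> level_cell lam j ` block f ?N j c" and c: "c \<le> ?N"
      unfolding D_mem by blast
    then have "s \<in> block f ?N k c" "Suc s \<in> block f ?N k c" using mem[of s] mem[of "Suc s"] s by auto
    then have "Suc s \<in> block f ?N k s" using block_eq[OF c] by blast
    then show "k < f s" by (auto simp: block_def)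
  next
    assume k: "k < f s"
    then have "Suc s \<in> block f ?N k s" "s \<in> block f ?N k s" using s by (auto simp: block_def less_Suc_eq_le)
    moreover have "s \<le> ?N" "k < m s" using fm(1)[OF s] k s by simp_all
    then have "level_cell lam k ` block f ?N k s \<in> D" unfolding D_mem by blast
    ultimately show "joined lam D k s" unfolding joined_def by blast
  qed
  have "tiling_filling lam (mu, D) = fl"
  proof (rule nth_equalityI)
    fix s assume "s < length (tiling_filling lam (mu, D))"
    then have s: "s < ?N" by (simp add: tiling_filling_def)
    have "{k. joined lam D k s} = {..<f s}" using joined[OF s] by auto
    then have "crossings lam D s = f s" by (simp add: crossings_def)
    moreover have "gap lam mu (Suc s) = snd (fl ! s)" using gap[of "Suc s"] s by (simp add: m_def levels_def)
    ultimately show "tiling_filling lam (mu, D) ! s = fl ! s"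
      using s by (simp add: tiling_filling_def f_def prod_eq_iff)
  qed (simp add: tiling_filling_def len)
  then show ?thesis using T by blast
qed

lemma tilings_gf_eq_filling_gf:
  assumes lam: "dyck_path n lam"
  shows "(\<Sum>T\<in>dyck_tilings n lam. q ^ art lam T) = filling_gf lam [0] 0"
proof -
  have "bij_betw (tiling_filling lam) (dyck_tilings n lam) {fl. filling lam [0] 0 fl}"
    unfolding bij_betw_def
    using inj_tiling_filling[OF lam] filling_tiling_filling[OF lam] filling_is_tiling_filling[OF lam]
    by (auto simp: image_iff) metis
  then have "filling_gf lam [0] 0 = (\<Sum>T\<in>dyck_tilings n lam. q ^ weight lam (tiling_filling lam T))"
    unfolding filling_gf_def by (rule sum.reindex_bij_betw[symmetric])
  also have "\<dots> = (\<Sum>T\<in>dyck_tilings n lam. q ^ art lam T)"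
    using art_eq_weight[OF lam] by (intro sum.cong) auto
  finally show ?thesis ..
qed

section \<open>Dyck tilings and the left weak order\<close>

lemma qfact_nonzero: "qfact n \<noteq> 0"
proof -
  have "poly (qnum (Suc i)) 0 = 1" for i by (simp add: qnum_Suc q_def poly_monom)
  then have "poly (qfact n) 0 = 1" by (simp add: qfact_def poly_prod)
  then show ?thesis by auto
qed

theorem theorem2p4:
  fixes n :: nat and lam :: "step list" and F :: "(nat \<times> nat) tree list"
    and L0 :: "nat \<times> nat \<Rightarrow> nat" and pi0 :: "nat list"
  assumes "dyck_path n lam"
    and "F = plane_forest lam"
    and "increasing_labeling n F L0"
    and "pre F L0 = [1..<n + 1]"
    and "pi0 = post F L0"
  shows "(\<Sum>T \<in> dyck_tilings n lam. monom (1 :: int) (art lam T)) =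
         (\<Sum>w \<in> {w \<in> perms n. left_weak_le n pi0 w}. monom 1 (inversions w - inversions pi0))"
proof -
  have q_power: "monom 1 k = q ^ k" for k by (simp add: q_def monom_power)
  have size: "num_vertices F = n"
    using arg_cong[OF assms(4), of length] by (simp add: pre_def)
  have "mset pi0 = mset (pre F L0)"
    by (simp add: assms(5) post_def pre_def mset_forest_postorder)
  then have "mset pi0 = mset [1..<n + 1]" by (simp only: assms(4))
  then have "set pi0 = set [1..<n + 1]" "distinct pi0 \<longleftrightarrow> distinct [1..<n + 1]"
    by (rule mset_eq_setD, rule mset_eq_imp_distinct_iff)
  then have "set pi0 = {1..n}" "distinct pi0"
    by (simp_all only: set_upt distinct_upt Suc_eq_plus1[symmetric] atLeastLessThanSuc_atLeastAtMost)
  then have perm: "pi0 \<in> perms n" by (simp add: permutations_of_set_def)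
  have sorted: "sorted_wrt (<) (pre F L0)" by (simp only: assms(4) sorted_wrt_upt)
  define R where "R = (\<Sum>w \<in> {w \<in> perms n. left_weak_le n pi0 w}. q ^ (inversions w - inversions pi0))"
  have ideal: "{w \<in> perms n. left_weak_le n pi0 w} = {w. w \<in> perms n \<and> inv_positions pi0 \<subseteq> inv_positions w}"
    using left_weak_le_iff[OF perm] by blast
  have split: "q ^ inversions w = q ^ inversions pi0 * q ^ (inversions w - inversions pi0)"
    if "inv_positions pi0 \<subseteq> inv_positions w" for w
    using card_mono[OF finite_inv_positions that] by (simp add: inversions_alt flip: power_add)
  have R: "above_gf pi0 {1..n} = q ^ inversions pi0 * R"
    unfolding above_gf_def R_def ideal sum_distrib_left by (rule sum.cong[OF refl], rule split) simp
  have "qfact n * (q ^ inversions pi0 * (\<Sum>T \<in> dyck_tilings n lam. q ^ art lam T))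
      = qfact n * (q ^ inversions pi0 * forest_op F (\<lambda>x. if x = 0 then 1 else 0) 0)"
    using tilings_gf_eq_filling_gf[OF assms(1)] filling_gf_word[of F] word_plane_forest[OF assms(1)] assms(2)
    by simp
  also have "\<dots> = above_gf pi0 {1..n} * qfact n"
    using forest_op_above_gf[OF sorted, of "{1..n}"] assms(5) size peaks_at_0[of n] by simp
  also have "\<dots> = qfact n * (q ^ inversions pi0 * R)" by (simp only: R mult.commute)
  finally have "(\<Sum>T \<in> dyck_tilings n lam. q ^ art lam T) = R"
    using qfact_nonzero by (simp add: q_def)
  then show ?thesis by (simp only: R_def q_power)
qed

end
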